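(* The automorphism group of a binary cyclic code is not isomorphic (as an abstract group) to an alternating group $\operatorname{Alt}(n)$ of degree $n\in\{3,4,5,6,7\}$ or $n\ge 9$. The group $\operatorname{Alt}(8)$ occurs (up to isomorphism of abstract groups) as the automorphism group of a binary cyclic code of length $15$.
   Context: A binary linear code of length $N$ ($N$ a positive integer) is a linear subspace $\mathcal{C}$ of $\mathbb{F}_2^N$. The symmetric group $\operatorname{Sym}(N)$ acts on $\mathbb{F}_2^N$ by coordinate permutations, and the automorphism group $\operatorname{Aut}(\mathcal{C})\le\operatorname{Sym}(N)$ is the subgroup of all permutations mapping the subspace $\mathcal{C}$ into itself. The code $\mathcal{C}$ is called cyclic if $\operatorname{Aut}(\mathcal{C})$ contains a regular cycle of length $N$ (i.e. an $N$-cycle). *)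

theory Defs
  imports
    "HOL-Algebra.Sym_Groups"
    "HOL-Library.Z2"
    "Jordan_Normal_Form.VS_Connect"
begin

definition binary_linear_code :: "nat \<Rightarrow> bit vec set \<Rightarrow> bool" where
  "binary_linear_code N C \<longleftrightarrow>
     N > 0 \<and> VectorSpace.subspace class_ring C (module_vec TYPE(bit) N)"

text \<open>Vectors of \<^typ>\<open>bit vec\<close> are indexed from 0, so Sym(N) is realised on \<open>{..<N}\<close> here,
  whereas \<^const>\<open>sym_group\<close> acts on \<open>{1..N}\<close>.\<close>

definition coord_sym :: "nat \<Rightarrow> (nat \<Rightarrow> nat) monoid" where
  "coord_sym N = \<lparr> carrier = {p. p permutes {..<N}}, mult = (\<circ>), one = id \<rparr>"

text \<open>The left action: the entry in position \<open>i\<close> moves to position \<open>p i\<close>.\<close>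

definition permute_coords :: "(nat \<Rightarrow> nat) \<Rightarrow> bit vec \<Rightarrow> bit vec" where
  "permute_coords p v = vec (dim_vec v) (\<lambda>i. v $ inv' p i)"

definition code_aut :: "nat \<Rightarrow> bit vec set \<Rightarrow> (nat \<Rightarrow> nat) monoid" where
  "code_aut N C =
     (coord_sym N) \<lparr> carrier := {p \<in> carrier (coord_sym N). permute_coords p ` C \<subseteq> C} \<rparr>"

definition binary_cyclic_code :: "nat \<Rightarrow> bit vec set \<Rightarrow> bool" where
  "binary_cyclic_code N C \<longleftrightarrow> binary_linear_code N C \<and>
     (\<exists>cs. cycle cs \<and> set cs = {..<N} \<and> cycle_of_list cs \<in> carrier (code_aut N C))"

lemma group_coord_sym: "group (coord_sym N)"
proof (rule groupI)
  fix p assume "p \<in> carrier (coord_sym N)"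
  then have "p permutes {..<N}" by (simp add: coord_sym_def)
  then have "inv' p permutes {..<N}" "inv' p \<circ> p = id"
    by (rule permutes_inv, rule permutes_inv_o)
  then show "\<exists>q\<in>carrier (coord_sym N). q \<otimes>\<^bsub>coord_sym N\<^esub> p = \<one>\<^bsub>coord_sym N\<^esub>"
    by (intro bexI[of _ "inv' p"]) (simp_all add: coord_sym_def)
qed (simp_all add: coord_sym_def permutes_compose permutes_id o_assoc)

lemma permute_coords_compose:
  assumes "p permutes {..<N}" "q permutes {..<N}" "v \<in> carrier_vec N"
  shows "permute_coords (p \<circ> q) v = permute_coords p (permute_coords q v)"
proof -
  have "inv' (p \<circ> q) = inv' q \<circ> inv' p"
    using assms by (simp add: o_inv_distrib permutes_bij)
  moreover have "inv' p i < N" if "i < N" for i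
    using permutes_in_image[OF permutes_inv[OF assms(1)]] that by auto
  ultimately show ?thesis
    using assms(3) by (auto simp: permute_coords_def)
qed

lemma permute_coords_id: "permute_coords id v = v"
  by (auto simp: permute_coords_def)

lemma binary_linear_code_carrier: "binary_linear_code N C \<Longrightarrow> C \<subseteq> carrier_vec N"
  unfolding binary_linear_code_def subspace_def submodule_def by (simp add: module_vec_simps)

lemma finite_binary_code:
  assumes "C \<subseteq> carrier_vec N"
  shows "finite (C :: bit vec set)"
proof (rule finite_subset)
  show "finite (vec N ` ({..<N} \<rightarrow>\<^sub>E (UNIV :: bit set)))"
  proof (intro finite_imageI finite_PiE)
    show "finite (UNIV :: bit set)"
    proof (rule finite_subset)
      show "(UNIV :: bit set) \<subseteq> {0, 1}"
      proof
        fix b :: bit show "b \<in> {0, 1}" by (cases b) simp_all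
      qed
    qed simp
  qed simp
  show "C \<subseteq> vec N ` ({..<N} \<rightarrow>\<^sub>E (UNIV :: bit set))"
  proof
    fix v assume "v \<in> C"
    then have "dim_vec v = N" using assms carrier_vecD by blast
    then have "v = vec N (restrict (vec_index v) {..<N})" by (intro eq_vecI) simp_all
    then show "v \<in> vec N ` ({..<N} \<rightarrow>\<^sub>E (UNIV :: bit set))"
      by (rule image_eqI[where x = "restrict (vec_index v) {..<N}"]) simp
  qed
qed

lemma subgroup_code_aut:
  assumes "binary_linear_code N C"
  shows "subgroup (carrier (code_aut N C)) (coord_sym N)"
proof -
  interpret group "coord_sym N" by (rule group_coord_sym)
  have C: "C \<subseteq> carrier_vec N" by (rule binary_linear_code_carrier[OF assms])
  have p: "p permutes {..<N}" if "p \<in> carrier (coord_sym N)" for p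
    using that by (simp add: coord_sym_def)
  show ?thesis
  proof (rule subgroupI)
    have "id \<in> carrier (code_aut N C)"
      by (simp add: code_aut_def coord_sym_def permute_coords_id permutes_id image_subset_iff)
    then show "carrier (code_aut N C) \<noteq> {}" by blast
  next
    fix a b assume ab: "a \<in> carrier (code_aut N C)" "b \<in> carrier (code_aut N C)"
    have "permute_coords (a \<circ> b) v \<in> C" if "v \<in> C" for v
    proof -
      have "permute_coords (a \<circ> b) v = permute_coords a (permute_coords b v)"
        using ab that C by (intro permute_coords_compose) (auto simp: code_aut_def p)
      moreover have "permute_coords b v \<in> C" using ab(2) that by (auto simp: code_aut_def)
      ultimately show ?thesis using ab(1) by (auto simp: code_aut_def)
    qed
    then show "a \<otimes>\<^bsub>coord_sym N\<^esub> b \<in> carrier (code_aut N C)"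
      using ab by (auto simp: code_aut_def coord_sym_def permutes_compose)
  next
    fix a assume a: "a \<in> carrier (code_aut N C)"
    let ?b = "m_inv (coord_sym N) a"
    have ac: "a \<in> carrier (coord_sym N)" and sub: "permute_coords a ` C \<subseteq> C"
      using a by (auto simp: code_aut_def)
    have bc: "?b \<in> carrier (coord_sym N)" using ac by simp
    have ba: "?b \<circ> a = id" using l_inv[OF ac] by (simp add: coord_sym_def)
    have *: "permute_coords ?b (permute_coords a v) = v" if "v \<in> C" for v
    proof -
      have "v \<in> carrier_vec N" using that C by blast
      from permute_coords_compose[OF p[OF bc] p[OF ac] this, symmetric] show ?thesis
        unfolding ba permute_coords_id .
    qed
    then have "inj_on (permute_coords a) C" by (rule inj_on_inverseI)
    then have "permute_coords a ` C = C"
      by (rule endo_inj_surj[OF finite_binary_code[OF C] sub])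
    then have "permute_coords ?b ` C = (\<lambda>v. permute_coords ?b (permute_coords a v)) ` C"
      by (metis image_image)
    also have "\<dots> = C" using * by simp
    finally have "permute_coords ?b ` C \<subseteq> C" by (rule equalityD1)
    then show "?b \<in> carrier (code_aut N C)" using bc by (simp add: code_aut_def)
  qed (auto simp: code_aut_def)
qed

end

theory Submission
  imports Defs
begin

text \<open>The negative half rests on one statement about permutation groups: if Alt(n), with \<open>3 \<le> n\<close> and \<open>n \<noteq> 8\<close>, acts faithfully
on N points and some element z acts as an N-cycle, then N = n (\<open>degree_eq\<close>). For N = n the automorphism group would
have index two in Sym(n) and hence contain all three-cycles, which are squares. But on a binary word every
transposition has the same effect as the identity or a suitable three-cycle, because among three bits two agree. So a
code invariant under all three-cycles is invariant under all permutations, and its group is too large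
(\<open>code_aut_not_alternating\<close>).

To see that N = n, note first that N is odd: three-cycles are squares, so Alt(n) acts by even permutations, while an
N-cycle is even only for odd N. Therefore commuting involutions have a common fixed point among the N points. Apply
this to the products of two transpositions along the matching \<open>{1, 2}, {3, 4}, \<dots>\<close>: they all lie in one point
stabilizer H. On the other hand, transitivity of z on the N points makes every element of Alt(n) a power of z times an
element of H. If N > n, then z is not transitive on the original n points and has an invariant set of some size a with
\<open>2 \<le> a \<le> n / 2\<close>; the factorization turns this into transitivity of H on all subsets of size a
(\<open>stabilizer_homogeneous\<close>). Hence H moves the matching, and for \<open>9 \<le> n\<close> the matching and its image overlap in a way that
produces a three-cycle (\<open>three_cycle_from_moved_pair\<close>). An argument in the style of Jordan, with a maximal set \<open>\<Delta>\<close> such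
that Alt(\<open>\<Delta>\<close>) lies in H, then gives H = Alt(n), a contradiction. For \<open>n \<le> 7\<close> permutations of odd order have order at
most n, so N > n is excluded at once. At n = 8 the matching has only four edges and the argument breaks down, as it
must.

For the positive half the code is the simplex code of length 15 and dimension 4, whose automorphism group is GL(4,2).
The exceptional isomorphism with Alt(8) becomes visible on the structures of affine three-space over the field with two
elements that eight points can carry. Fifteen of them form one orbit of Alt(8), and they are permuted cyclically by an
element \<open>zeta\<close> of cycle type 5 + 3. Any two of them share exactly a pair of complementary blocks, and exactly one further
structure contains the same pair: these triples are the lines of the projective space, and the code consists of the
words that sum to zero on all lines. This yields an embedding of Alt(8) into the automorphism group
(\<open>alt8_action_inj\<close>, \<open>alt8_action_code_aut\<close>), and counting the possible images of four independent points shows that there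
is no room for more (\<open>simplex_code_aut_card\<close>).\<close>

section \<open>Three-cycles in permutation groups\<close>

lemma two_distinct_elements:
  assumes "2 \<le> card X"
  obtains a b where "a \<in> X" "b \<in> X" "a \<noteq> b"
proof -
  obtain T where "T \<subseteq> X" "card T = 2" using obtain_subset_with_card_n[OF assms] by blast
  then show ?thesis using that by (auto simp: card_2_iff)
qed

definition three_cycle :: "'a \<Rightarrow> 'a \<Rightarrow> 'a \<Rightarrow> 'a \<Rightarrow> 'a" where
  "three_cycle a b c = transpose a b \<circ> transpose b c"

lemma conj_transpose:
  assumes "bij h"
  shows "h \<circ> transpose a b \<circ> inv' h = transpose (h a) (h b)"
proof -
  have "transpose (h a) (h b) \<circ> h = h \<circ> transpose a b"
    using transpose_comp_eq[OF assms, of "h a" "h b"] assms by (simp add: bij_is_inj)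
  then have "h \<circ> transpose a b \<circ> inv' h = transpose (h a) (h b) \<circ> (h \<circ> inv' h)"
    by (simp add: o_assoc)
  then show ?thesis
    using assms by (simp add: surj_iff[THEN iffD1, OF bij_is_surj])
qed

lemma conj_three_cycle:
  assumes "bij h"
  shows "h \<circ> three_cycle a b c \<circ> inv' h = three_cycle (h a) (h b) (h c)"
proof -
  have "h \<circ> (f \<circ> g) \<circ> inv' h = (h \<circ> f \<circ> inv' h) \<circ> (h \<circ> g \<circ> inv' h)" for f g
    using assms by (simp add: fun_eq_iff bij_is_inj)
  then show ?thesis
    by (simp only: three_cycle_def conj_transpose[OF assms])
qed

lemma three_cycle_apply:
  assumes "distinct [a, b, c]"
  shows "three_cycle a b c x = (if x = a then b else if x = b then c else if x = c then a else x)"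
  using assms by (auto simp: three_cycle_def transpose_def)

lemma three_cycle_rotate: "distinct [a, b, c] \<Longrightarrow> three_cycle b c a = three_cycle a b c"
  by (auto simp: three_cycle_apply fun_eq_iff)

text \<open>The right-hand side is also the inverse; so every three-cycle is a square.\<close>

lemma three_cycle_square: "distinct [a, b, c] \<Longrightarrow> three_cycle a b c \<circ> three_cycle a b c = three_cycle c b a"
  by (auto simp: three_cycle_apply fun_eq_iff)

locale permutation_group =
  fixes \<Omega> :: "'a set" and H :: "('a \<Rightarrow> 'a) set"
  assumes finite_points: "finite \<Omega>"
    and permutes: "h \<in> H \<Longrightarrow> h permutes \<Omega>"
    and id_closed: "id \<in> H"
    and comp_closed: "g \<in> H \<Longrightarrow> h \<in> H \<Longrightarrow> g \<circ> h \<in> H"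
    and inv_closed: "h \<in> H \<Longrightarrow> inv' h \<in> H"
begin

lemma bij: "h \<in> H \<Longrightarrow> bij h"
  using permutes permutes_bij by blast

lemma conj_three_cycle_mem:
  assumes "h \<in> H" "three_cycle a b c \<in> H"
  shows "three_cycle (h a) (h b) (h c) \<in> H"
  using comp_closed[OF comp_closed[OF assms] inv_closed[OF assms(1)]]
  by (simp add: conj_three_cycle[OF bij[OF assms(1)]])

lemma three_cycle_reverse_mem:
  "distinct [a, b, c] \<Longrightarrow> three_cycle a b c \<in> H \<Longrightarrow> three_cycle c b a \<in> H"
  using comp_closed[of "three_cycle a b c" "three_cycle a b c"] by (simp add: three_cycle_square)

lemma three_cycle_rotate_mem:
  "distinct [a, b, c] \<Longrightarrow> three_cycle a b c \<in> H \<Longrightarrow> three_cycle b c a \<in> H"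
  by (simp only: three_cycle_rotate)

definition contains_alt :: "'a set \<Rightarrow> bool" where
  "contains_alt \<Delta> \<longleftrightarrow> \<Delta> \<subseteq> \<Omega> \<and> (\<forall>a\<in>\<Delta>. \<forall>b\<in>\<Delta>. \<forall>c\<in>\<Delta>. distinct [a, b, c] \<longrightarrow> three_cycle a b c \<in> H)"

lemma contains_altD:
  "contains_alt \<Delta> \<Longrightarrow> a \<in> \<Delta> \<Longrightarrow> b \<in> \<Delta> \<Longrightarrow> c \<in> \<Delta> \<Longrightarrow> a \<noteq> b \<Longrightarrow> b \<noteq> c \<Longrightarrow> a \<noteq> c \<Longrightarrow> three_cycle a b c \<in> H"
  by (simp add: contains_alt_def)

lemma contains_alt_triple:
  assumes "distinct [a, b, c]" "{a, b, c} \<subseteq> \<Omega>" "three_cycle a b c \<in> H"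
  shows "contains_alt {a, b, c}"
proof -
  have r: "three_cycle c b a \<in> H" by (rule three_cycle_reverse_mem[OF assms(1,3)])
  have "three_cycle b c a \<in> H" using three_cycle_rotate_mem[of a b c] assms by auto
  moreover from this have "three_cycle c a b \<in> H" using three_cycle_rotate_mem[of b c a] assms by auto
  moreover have "three_cycle b a c \<in> H" using three_cycle_rotate_mem[of c b a] assms r by auto
  moreover from this have "three_cycle a c b \<in> H" using three_cycle_rotate_mem[of b a c] assms r by auto
  ultimately show ?thesis
    using assms r unfolding contains_alt_def by auto
qed

lemma contains_alt_image:
  assumes "h \<in> H" "contains_alt \<Delta>"
  shows "contains_alt (h ` \<Delta>)"
  unfolding contains_alt_def
proof (intro conjI ballI impI)
  show "h ` \<Delta> \<subseteq> \<Omega>"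
    using assms permutes_image[OF permutes[OF assms(1)]] unfolding contains_alt_def by blast
  fix a b c assume "a \<in> h ` \<Delta>" "b \<in> h ` \<Delta>" "c \<in> h ` \<Delta>" and d: "distinct [a, b, c]"
  then obtain a' b' c' where "a = h a'" "b = h b'" "c = h c'" "a' \<in> \<Delta>" "b' \<in> \<Delta>" "c' \<in> \<Delta>"
    by blast
  then show "three_cycle a b c \<in> H"
    using d assms contains_altD[OF assms(2), of a' b' c'] conj_three_cycle_mem by force
qed

text \<open>One three-cycle that leaves \<open>\<Delta>\<close> in a single point suffices to absorb that point: conjugation by
three-cycles inside \<open>\<Delta>\<close> moves the two other points of the cycle anywhere in \<open>\<Delta>\<close>, and inversion swaps them.
This works already when \<open>\<Delta>\<close> has only three points.\<close>

lemma contains_alt_insert: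
  assumes alt: "contains_alt \<Delta>" and v: "v \<in> \<Omega>" "v \<notin> \<Delta>"
    and sy: "s \<in> \<Delta>" "y \<in> \<Delta>" "s \<noteq> y" "three_cycle s y v \<in> H"
  shows "contains_alt (insert v \<Delta>)"
proof -
  have rev: "three_cycle b a v \<in> H" if "three_cycle a b v \<in> H" "a \<in> \<Delta>" "b \<in> \<Delta>" "a \<noteq> b" for a b
  proof -
    have "three_cycle v b a \<in> H" using that v by (intro three_cycle_reverse_mem[of a b v, OF _ that(1)]) auto
    then show ?thesis using that v three_cycle_rotate_mem[of v b a] by auto
  qed
  have step: "three_cycle b c v \<in> H"
    if "three_cycle a b v \<in> H" "a \<in> \<Delta>" "b \<in> \<Delta>" "c \<in> \<Delta>" "a \<noteq> b" "b \<noteq> c" for a b c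
  proof (cases "c = a")
    case True then show ?thesis using rev that by blast
  next
    case False
    have "three_cycle a b c \<in> H" using contains_altD[OF alt] that False by blast
    moreover have "v \<noteq> a" "v \<noteq> b" "v \<noteq> c" using that v by blast+
    ultimately show ?thesis
      using conj_three_cycle_mem[of "three_cycle a b c" a b v] that False
      by (auto simp: three_cycle_apply)
  qed
  have all: "three_cycle a b v \<in> H" if "a \<in> \<Delta>" "b \<in> \<Delta>" "a \<noteq> b" for a b
  proof (cases "a = y")
    case True then show ?thesis using step sy that by blast
  next
    case False
    then have "three_cycle y a v \<in> H" using step sy that by blast
    then show ?thesis using step False sy that by blast
  qed
  show ?thesis unfolding contains_alt_def
  proof (intro conjI ballI impI)
    show "insert v \<Delta> \<subseteq> \<Omega>" using alt v by (auto simp: contains_alt_def)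
    fix a b c assume abc: "a \<in> insert v \<Delta>" "b \<in> insert v \<Delta>" "c \<in> insert v \<Delta>"
      and d: "distinct [a, b, c]"
    consider "c = v" | "a = v" | "b = v" | "a \<in> \<Delta>" "b \<in> \<Delta>" "c \<in> \<Delta>" using abc by blast
    then show "three_cycle a b c \<in> H"
    proof cases
      case 1 then show ?thesis using all abc d by auto
    next
      case 2
      then have "three_cycle b c v \<in> H" using all abc d by auto
      then show ?thesis using 2 d three_cycle_rotate_mem[of b c a] three_cycle_rotate_mem[of c a b] by auto
    next
      case 3
      then have "three_cycle c a v \<in> H" using all abc d by auto
      then show ?thesis using 3 d three_cycle_rotate_mem[of c a b] by auto
    next
      case 4 then show ?thesis using contains_altD[OF alt] d by auto
    qed
  qed
qed

text \<open>Two overlapping sets fuse point by point. If the three-cycle at hand meets \<open>\<Delta>\<close> in two points, the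
previous lemma applies; if it meets \<open>\<Delta>\<close> only in \<open>y\<close>, it conjugates a three-cycle through \<open>y\<close> inside \<open>\<Delta>\<close>
into one that leaves \<open>\<Delta>\<close> only in \<open>v\<close>.\<close>

lemma contains_alt_overlap:
  assumes alt: "contains_alt \<Delta>" "contains_alt \<Delta>'" and card: "3 \<le> card \<Delta>" "3 \<le> card \<Delta>'"
    and y: "y \<in> \<Delta>" "y \<in> \<Delta>'" and v: "v \<in> \<Delta>'" "v \<notin> \<Delta>"
  shows "contains_alt (insert v \<Delta>)"
proof -
  have fin: "finite \<Delta>" "finite \<Delta>'"
    using alt finite_points by (auto simp: contains_alt_def intro: finite_subset)
  have vO: "v \<in> \<Omega>" using alt v by (auto simp: contains_alt_def)
  have "\<not> \<Delta>' \<subseteq> {y, v}"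
    using card(2) card_mono[of "{y, v}" \<Delta>'] card_insert_le_m1[of 2 "{v}" y] by auto
  then obtain s where s: "s \<in> \<Delta>'" "s \<noteq> y" "s \<noteq> v" by blast
  show ?thesis
  proof (cases "s \<in> \<Delta>")
    case True
    have "three_cycle s y v \<in> H" using contains_altD[OF alt(2)] s y v by blast
    then show ?thesis using contains_alt_insert[OF alt(1) vO v(2) True y(1) s(2)] by blast
  next
    case False
    have "2 \<le> card (\<Delta> - {y})" using fin card y by simp
    then obtain a b where ab: "a \<in> \<Delta> - {y}" "b \<in> \<Delta> - {y}" "a \<noteq> b"
      by (rule two_distinct_elements)
    have "three_cycle a b y \<in> H" using contains_altD[OF alt(1)] ab y by blast
    moreover have "three_cycle y v s \<in> H" using contains_altD[OF alt(2)] s y v by blast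
    moreover have yv: "y \<noteq> v" using y v by blast
    ultimately have "three_cycle (three_cycle y v s a) (three_cycle y v s b) (three_cycle y v s y) \<in> H"
      using conj_three_cycle_mem by blast
    moreover have "three_cycle y v s a = a" "three_cycle y v s b = b" "three_cycle y v s y = v"
      using three_cycle_apply[of y v s] ab s yv v y False by auto
    ultimately have "three_cycle a b v \<in> H" by simp
    then show ?thesis using contains_alt_insert[OF alt(1) vO v(2)] ab by blast
  qed
qed

text \<open>Transitivity on \<open>a\<close>-subsets is incompatible with a proper block \<open>\<Delta>\<close>. If \<open>a\<close> is at most the size of \<open>\<Delta>\<close>, an
\<open>a\<close>-subset of \<open>\<Delta>\<close> would be carried to one that lies partly inside and partly outside \<open>\<Delta>\<close>. Otherwise an \<open>a\<close>-set containing
\<open>\<Delta>\<close> would be carried to one that misses a point of every translate of \<open>\<Delta>\<close>; such sets exist because the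
translates are disjoint and have at least three points, so a transversal uses at most a third of \<open>\<Omega>\<close>, while \<open>a\<close> is at most half of its size.\<close>

lemma homogeneous_block_trivial:
  assumes homog: "\<And>B B'. B \<subseteq> \<Omega> \<Longrightarrow> B' \<subseteq> \<Omega> \<Longrightarrow> card B = a \<Longrightarrow> card B' = a \<Longrightarrow> \<exists>h\<in>H. h ` B = B'"
    and a: "2 \<le> a" "2 * a \<le> card \<Omega>"
    and \<Delta>: "\<Delta> \<subseteq> \<Omega>" "3 \<le> card \<Delta>"
    and block: "\<And>h. h \<in> H \<Longrightarrow> h ` \<Delta> = \<Delta> \<or> h ` \<Delta> \<inter> \<Delta> = {}"
  shows "\<Delta> = \<Omega>"
proof (rule ccontr)
  assume ne: "\<Delta> \<noteq> \<Omega>"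
  have fin: "finite \<Delta>" using finite_points \<Delta> finite_subset by blast
  show False
  proof (cases "a \<le> card \<Delta>")
    case True
    then obtain B where B: "B \<subseteq> \<Delta>" "card B = a" by (rule obtain_subset_with_card_n)
    obtain v where v: "v \<in> \<Omega>" "v \<notin> \<Delta>" using ne \<Delta> by blast
    have finB: "finite B" using B fin finite_subset by blast
    obtain b b' where b: "b \<in> B" "b' \<in> B" "b \<noteq> b'"
      using a(1) B(2) two_distinct_elements[of B] by auto
    let ?B' = "insert v (B - {b})"
    have "v \<notin> B - {b}" using v B by blast
    then have "card ?B' = a" using finB b B a by (simp add: card_Suc_Diff1)
    then obtain h where h: "h \<in> H" "h ` B = ?B'"
      using homog[of B ?B'] B \<Delta> v by blast
    have "b' \<in> h ` \<Delta>" "v \<in> h ` \<Delta>" using h B b by blast+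
    then show False using block[OF h(1)] v B b by blast
  next
    case False
    obtain B where B: "\<Delta> \<subseteq> B" "B \<subseteq> \<Omega>" "card B = a"
    proof -
      obtain D where "D \<subseteq> \<Omega> - \<Delta>" "card D = a - card \<Delta>"
      proof -
        have "a - card \<Delta> \<le> card (\<Omega> - \<Delta>)" using a \<Delta> fin by (simp add: card_Diff_subset)
        then show ?thesis using that by (metis obtain_subset_with_card_n)
      qed
      moreover from this have "finite D" using finite_points finite_subset by blast
      ultimately have "card (\<Delta> \<union> D) = a" using fin False by (subst card_Un_disjoint) auto
      then show ?thesis using that[of "\<Delta> \<union> D"] \<Delta> \<open>D \<subseteq> _\<close> by auto
    qed
    let ?F = "(\<lambda>h. h ` \<Delta>) ` H"
    have sub: "X \<subseteq> \<Omega>" if "X \<in> ?F" for X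
      using that permutes_image[OF permutes] \<Delta>(1) by blast
    have cX: "card X = card \<Delta>" if "X \<in> ?F" for X
      using that card_image[OF inj_on_subset[OF bij_is_inj[OF bij]]] by blast
    have disj: "X \<inter> Y = {}" if XY: "X \<in> ?F" "Y \<in> ?F" "X \<noteq> Y" for X Y
    proof -
      obtain g h where gh: "g \<in> H" "h \<in> H" "X = g ` \<Delta>" "Y = h ` \<Delta>" using XY by blast
      have inv: "inv' g \<circ> h \<in> H" using comp_closed inv_closed gh by blast
      have bg: "bij g" using bij gh by blast
      have img: "g ` ((inv' g \<circ> h) ` \<Delta>) = Y"
        using gh bg by (simp add: image_image bij_is_surj surj_f_inv_f)
      then have "(inv' g \<circ> h) ` \<Delta> \<noteq> \<Delta>" using gh XY by auto
      then have "(inv' g \<circ> h) ` \<Delta> \<inter> \<Delta> = {}" using block[OF inv] by blast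
      then have "g ` ((inv' g \<circ> h) ` \<Delta>) \<inter> g ` \<Delta> = {}"
        using image_Int[OF bij_is_inj[OF bg]] by (metis image_empty)
      then show ?thesis using img gh by auto
    qed
    have finF: "finite ?F" using sub finite_points by (meson Pow_iff finite_Pow_iff finite_subset subsetI)
    have subU: "\<Union> ?F \<subseteq> \<Omega>" using sub by blast
    have "card \<Delta> * card ?F = card (\<Union> ?F)"
      using finF finite_subset[OF subU finite_points] cX disj by (rule card_partition)
    also have "\<dots> \<le> card \<Omega>" using card_mono[OF finite_points subU] .
    finally have "3 * card ?F \<le> card \<Omega>" using \<Delta>(2) by (meson le_trans mult_le_mono1)
    define t where "t X = (SOME x. x \<in> X)" for X :: "'a set"
    have t: "t X \<in> X" if "X \<in> ?F" for X
    proof -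
      have "X \<noteq> {}" using cX[OF that] \<Delta>(2) by auto
      then show ?thesis unfolding t_def by (simp add: some_in_eq)
    qed
    have "card (t ` ?F) \<le> card ?F" using finF by (rule card_image_le)
    moreover have "t ` ?F \<subseteq> \<Omega>" using t sub by blast
    ultimately have "a \<le> card (\<Omega> - t ` ?F)"
      using \<open>3 * card ?F \<le> card \<Omega>\<close> a finF by (simp add: card_Diff_subset)
    then obtain B' where B': "B' \<subseteq> \<Omega> - t ` ?F" "card B' = a" by (rule obtain_subset_with_card_n)
    then obtain h where h: "h \<in> H" "h ` B = B'" using homog[of B B'] B by blast
    have "t (h ` \<Delta>) \<in> h ` B" using t[of "h ` \<Delta>"] h B by blast
    then show False using h B' by blast
  qed
qed

text \<open>A maximal \<open>\<Delta>\<close> whose alternating group is contained in \<open>H\<close> is a block: a translate that overlaps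
it without being equal to it could be absorbed.\<close>

lemma homogeneous_with_three_cycle:
  assumes homog: "\<And>B B'. B \<subseteq> \<Omega> \<Longrightarrow> B' \<subseteq> \<Omega> \<Longrightarrow> card B = a \<Longrightarrow> card B' = a \<Longrightarrow> \<exists>h\<in>H. h ` B = B'"
    and a: "2 \<le> a" "2 * a \<le> card \<Omega>"
    and uwx: "distinct [u, w, x]" "{u, w, x} \<subseteq> \<Omega>" "three_cycle u w x \<in> H"
  shows "contains_alt \<Omega>"
proof -
  define P where "P \<Delta> \<longleftrightarrow> contains_alt \<Delta> \<and> 3 \<le> card \<Delta>" for \<Delta>
  have "P {u, w, x}" unfolding P_def using contains_alt_triple[OF uwx] uwx(1) by auto
  moreover have "card \<Delta> < Suc (card \<Omega>)" if "P \<Delta>" for \<Delta>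
    using that card_mono[OF finite_points, of \<Delta>] unfolding P_def contains_alt_def by simp
  ultimately obtain \<Delta> where \<Delta>: "P \<Delta>" and max: "\<And>\<Delta>'. P \<Delta>' \<Longrightarrow> card \<Delta>' \<le> card \<Delta>"
    using ex_has_greatest_nat[of P "{u, w, x}" card "Suc (card \<Omega>)"] by (metis less_imp_le_nat)
  have sub: "\<Delta> \<subseteq> \<Omega>" using \<Delta> by (auto simp: P_def contains_alt_def)
  then have fin: "finite \<Delta>" using finite_points finite_subset by blast
  have "h ` \<Delta> = \<Delta> \<or> h ` \<Delta> \<inter> \<Delta> = {}" if h: "h \<in> H" for h
  proof (rule ccontr)
    assume neg: "\<not> ?thesis"
    have c: "card (h ` \<Delta>) = card \<Delta>"
      using card_image[OF inj_on_subset[OF bij_is_inj[OF bij[OF h]]]] by blast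
    then have "\<not> h ` \<Delta> \<subseteq> \<Delta>" using neg fin card_subset_eq by blast
    then obtain v y where v: "v \<in> h ` \<Delta>" "v \<notin> \<Delta>" "y \<in> h ` \<Delta>" "y \<in> \<Delta>" using neg by blast
    have "contains_alt (insert v \<Delta>)"
      using contains_alt_overlap[of \<Delta> "h ` \<Delta>" y v] contains_alt_image[OF h] \<Delta> c v
      unfolding P_def by auto
    then have "P (insert v \<Delta>)" using \<Delta> fin v unfolding P_def by simp
    then show False using max fin v by fastforce
  qed
  then have "\<Delta> = \<Omega>"
    using homogeneous_block_trivial[OF homog a sub] \<Delta> unfolding P_def by blast
  then show ?thesis using \<Delta> unfolding P_def by simp
qed

end

section \<open>Double transpositions along a matching\<close>

text \<open>The pairs of the matching are numbered from zero, the points from one. For odd \<open>n\<close> the last point is unmatched,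
and then its \<open>pair_index\<close> is \<open>n div 2\<close>, just beyond the indices of the pairs.\<close>

definition pair_swap :: "nat \<Rightarrow> nat \<Rightarrow> nat" where
  "pair_swap k = transpose (2 * k + 1) (2 * k + 2)"

definition pair_index :: "nat \<Rightarrow> nat" where
  "pair_index i = (i - 1) div 2"

lemma pair_index_simps [simp]: "pair_index (2 * k + 1) = k" "pair_index (2 * k + 2) = k"
    "pair_index (Suc (2 * k)) = k" "pair_index (Suc (Suc (2 * k))) = k"
  by (simp_all add: pair_index_def)

lemma partner_exists:
  assumes "1 \<le> i"
  obtains j where "1 \<le> j" "i \<noteq> j" "pair_index j = pair_index i" "pair_swap (pair_index i) = transpose i j"
proof (cases "odd i")
  case True
  then obtain k where "i = 2 * k + 1" by (rule oddE)
  then show ?thesis using that[of "2 * k + 2"] by (simp add: pair_swap_def)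
next
  case False
  then obtain k where "i = 2 * k" by blast
  with assms have "i = 2 * (k - 1) + 2" by simp
  then obtain k' where "i = 2 * k' + 2" by blast
  then show ?thesis using that[of "2 * k' + 1"]
    by (simp add: pair_swap_def transpose_commute)
qed

lemma pair_index_less: "1 \<le> i \<Longrightarrow> pair_index i < m \<longleftrightarrow> i \<le> 2 * m"
  by (auto simp: pair_index_def)

lemma exists_less_notin:
  assumes "finite F" "card F < m"
  obtains k :: nat where "k < m" "k \<notin> F"
proof -
  have "\<not> {..<m} \<subseteq> F" using card_mono[OF assms(1), of "{..<m}"] assms(2) by auto
  then show ?thesis using that by blast
qed

text \<open>Two double transpositions whose supports share exactly one point: their product is a three-cycle times two
transpositions that commute with it, so its square is a three-cycle.\<close>

lemma (in permutation_group) three_cycle_from_overlapping_swaps: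
  assumes "transpose u w \<circ> transpose p q \<in> H" "transpose w x \<circ> transpose r s \<in> H"
    and d: "distinct [u, w, x, p, q, r, s]"
  shows "three_cycle u w x \<in> H"
proof -
  let ?e = "(transpose w x \<circ> transpose r s) \<circ> (transpose u w \<circ> transpose p q)"
  have neq: "u \<noteq> w" "u \<noteq> x" "u \<noteq> p" "u \<noteq> q" "u \<noteq> r" "u \<noteq> s" "w \<noteq> x" "w \<noteq> p" "w \<noteq> q" "w \<noteq> r" "w \<noteq> s"
    "x \<noteq> p" "x \<noteq> q" "x \<noteq> r" "x \<noteq> s" "p \<noteq> q" "p \<noteq> r" "p \<noteq> s" "q \<noteq> r" "q \<noteq> s" "r \<noteq> s"
    using d by auto
  note neqs = neq neq[symmetric]
  have "(?e \<circ> ?e) y = three_cycle u w x y" for y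
  proof -
    consider "y = u" | "y = w" | "y = x" | "y = p" | "y = q" | "y = r" | "y = s"
      | "y \<notin> {u, w, x, p, q, r, s}" by blast
    then show ?thesis
      by cases (simp_all add: three_cycle_def transpose_def neqs)
  qed
  then have "?e \<circ> ?e = three_cycle u w x" by blast
  moreover have "?e \<circ> ?e \<in> H" using assms comp_closed by blast
  ultimately show ?thesis by simp
qed

locale permutation_group_with_matching = permutation_group "{1..n}" H for n :: nat and H +
  assumes matching: "k < n div 2 \<Longrightarrow> l < n div 2 \<Longrightarrow> k \<noteq> l \<Longrightarrow> pair_swap k \<circ> pair_swap l \<in> H"
begin

text \<open>Let \<open>h\<close> carry the pair \<open>{i, j}\<close> of the matching to \<open>{u, w}\<close>, which is not a pair of the matching, and let \<open>{w, x}\<close> be the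
pair through \<open>w\<close>. Both the matching and its image under \<open>h\<close> provide double transpositions in \<open>H\<close>.
Each of \<open>(u w)\<close> and \<open>(w x)\<close> needs a second transposition such that the supports share only \<open>w\<close>. For the
image matching at most two pairs are forbidden. For the original matching the forbidden pairs are those through \<open>w\<close>, \<open>p\<close>, \<open>q\<close> and \<open>u\<close>; hence
five pairs are enough, and four are enough if \<open>u\<close> is the unmatched point.\<close>

lemma three_cycle_from_moved_pair:
  assumes h: "h \<in> H" and ij: "i \<in> {1..n}" "j \<in> {1..n}" "i \<noteq> j" "pair_index i = pair_index j"
    and k: "pair_index i < n div 2"
    and w: "pair_index (h j) < n div 2" and u: "pair_index (h i) \<noteq> pair_index (h j)"
    and size: "5 \<le> n div 2 \<or> (4 \<le> n div 2 \<and> n div 2 \<le> pair_index (h i))"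
  obtains u w x where "distinct [u, w, x]" "{u, w, x} \<subseteq> {1..n}" "three_cycle u w x \<in> H"
proof -
  let ?m = "n div 2" and ?u = "h i" and ?w = "h j"
  have bij: "bij h" using bij[OF h] .
  have in_O: "h y \<in> {1..n} \<longleftrightarrow> y \<in> {1..n}" for y using permutes_in_image[OF permutes[OF h]] .
  have uw: "1 \<le> ?u" "1 \<le> ?w" "?u \<le> n" "?w \<le> n" using in_O ij by auto
  have swap_ij: "pair_swap (pair_index i) = transpose i j"
  proof -
    obtain j' where j': "1 \<le> j'" "i \<noteq> j'" "pair_index j' = pair_index i"
      "pair_swap (pair_index i) = transpose i j'"
      using partner_exists[of i] ij by auto
    then have "j' = j" using ij by (auto simp: pair_index_def)
    then show ?thesis using j' by simp
  qed
  obtain x where x: "1 \<le> x" "?w \<noteq> x" "pair_index x = pair_index ?w"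
    "pair_swap (pair_index ?w) = transpose ?w x"
    using partner_exists[OF uw(2)] by blast
  have xn: "x \<le> n" using pair_index_less[of x ?m] x w by auto
  let ?x' = "inv' h x"
  have hx': "h ?x' = x" using bij by (simp add: bij_is_surj surj_f_inv_f)
  have "card {pair_index i, pair_index ?x'} < ?m"
    using size by (auto simp: card_insert_if)
  then obtain k' where k': "k' < ?m" "k' \<notin> {pair_index i, pair_index ?x'}"
    using exists_less_notin[of "{pair_index i, pair_index ?x'}"] by blast
  define p q where "p = h (2 * k' + 1)" and "q = h (2 * k' + 2)"
  let ?F = "{pair_index ?w, pair_index p, pair_index q} \<union> ({pair_index ?u} \<inter> {..<?m})"
  have "card ?F < ?m"
  proof (cases "5 \<le> ?m")
    case True
    have "card ?F \<le> card {pair_index ?w, pair_index p, pair_index q, pair_index ?u}"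
      by (intro card_mono) auto
    also have "\<dots> \<le> 4" by (simp add: card_insert_if)
    finally show ?thesis using True by simp
  next
    case False
    then have "?F = {pair_index ?w, pair_index p, pair_index q}" using size by auto
    also have "card \<dots> \<le> 3" by (simp add: card_insert_if)
    finally show ?thesis using size by linarith
  qed
  then obtain l where l: "l < ?m" "l \<notin> ?F"
    using exists_less_notin[of ?F] by blast
  let ?r = "2 * l + 1" and ?s = "2 * l + 2"
  have l_idx: "l \<noteq> pair_index ?u" "l \<noteq> pair_index ?w" "l \<noteq> pair_index p" "l \<noteq> pair_index q"
    using l by auto
  have inj: "h a = h b \<longleftrightarrow> a = b" for a b using bij by (simp add: bij_is_inj inj_eq)
  have d1: "?u \<noteq> ?w" "p \<noteq> q" "?u \<noteq> p" "?u \<noteq> q" "?w \<noteq> p" "?w \<noteq> q"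
    using k' ij unfolding p_def q_def inj by auto
  have d2: "x \<noteq> p" "x \<noteq> q"
    using k' inj[of ?x' "2 * k' + 1"] inj[of ?x' "2 * k' + 2"] hx' unfolding p_def q_def by auto
  have "h \<circ> (transpose i j \<circ> pair_swap k') \<circ> inv' h = transpose ?u ?w \<circ> transpose p q"
  proof -
    have "h \<circ> (f \<circ> g) \<circ> inv' h = (h \<circ> f \<circ> inv' h) \<circ> (h \<circ> g \<circ> inv' h)" for f g
      using bij by (simp add: fun_eq_iff bij_is_inj)
    then show ?thesis
      by (simp only: pair_swap_def conj_transpose[OF bij] p_def q_def)
  qed
  moreover have "transpose i j \<circ> pair_swap k' \<in> H"
    using matching[of "pair_index i" k'] k k' swap_ij by auto
  ultimately have 1: "transpose ?u ?w \<circ> transpose p q \<in> H"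
    using comp_closed[OF comp_closed[OF h] inv_closed[OF h]] by metis
  have 2: "transpose ?w x \<circ> transpose ?r ?s \<in> H"
    using matching[of "pair_index ?w" l] w l l_idx x unfolding pair_swap_def[of l] by auto
  have "distinct [?u, ?w, x, p, q, ?r, ?s]"
    using d1 d2 x l_idx u by auto
  from three_cycle_from_overlapping_swaps[OF 1 2 this] show ?thesis
    using that[of ?u ?w x] d1 x xn uw u by auto
qed

text \<open>The group moves the matching: for odd \<open>n\<close> it moves the unmatched point, and for even \<open>n\<close> it carries a set containing
the pair \<open>{1, 2}\<close> to a set of odd numbers, which contains no pair.\<close>

lemma homogeneous_contains_alt:
  assumes homog: "\<And>B B'. B \<subseteq> {1..n} \<Longrightarrow> B' \<subseteq> {1..n} \<Longrightarrow> card B = a \<Longrightarrow> card B' = a \<Longrightarrow> \<exists>h\<in>H. h ` B = B'"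
    and a: "2 \<le> a" "2 * a \<le> n" and n: "9 \<le> n"
  shows "contains_alt {1..n}"
proof -
  obtain u w x where uwx: "distinct [u, w, x]" "{u, w, x} \<subseteq> {1..n}" "three_cycle u w x \<in> H"
  proof (cases "odd n")
    case True
    \<comment> \<open>The unmatched point \<open>n\<close> lies in the first set and not in the second.\<close>
    have "{n - a<..n} \<subseteq> {1..n}" "{1..a} \<subseteq> {1..n}" using a by auto
    then obtain h where h: "h \<in> H" "h ` {n - a<..n} = {1..a}"
      using homog[of "{n - a<..n}" "{1..a}"] a by auto
    have "h n \<in> {1..a}" using h(2) a by auto
    then have hn: "h n \<noteq> n" using a by auto
    have in_O: "h y \<in> {1..n} \<longleftrightarrow> y \<in> {1..n}" for y using permutes_in_image[OF permutes[OF h(1)]] .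
    have inj: "h a = h b \<longleftrightarrow> a = b" for a b using bij[OF h(1)] by (simp add: bij_is_inj inj_eq)
    obtain i where i: "h i = n" using bij[OF h(1)] by (metis bij_pointE)
    have i': "i \<in> {1..n}" "i \<noteq> n" using i in_O[of i] hn n by auto
    then obtain j where j: "1 \<le> j" "i \<noteq> j" "pair_index j = pair_index i"
      using partner_exists[of i] by auto
    have less: "pair_index y < n div 2 \<longleftrightarrow> y \<noteq> n" if "y \<in> {1..n}" for y
      using pair_index_less[of y "n div 2"] that True by auto
    have pi: "pair_index i < n div 2" using less i' by blast
    then have j': "j \<in> {1..n}" using j pair_index_less[of j "n div 2"] by auto
    have "h j \<noteq> n" using inj[of i j] i j by auto
    then have "pair_index (h j) < n div 2" using less[of "h j"] in_O j' by blast
    moreover have "\<not> pair_index (h i) < n div 2" using i less[of n] n by auto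
    moreover have "4 \<le> n div 2" using n by simp
    ultimately show ?thesis
      using three_cycle_from_moved_pair[OF h(1) i'(1) j' j(2) j(3)[symmetric] pi] that
      by (metis not_less)
  next
    case False
    let ?B' = "(\<lambda>k. 2 * k + 1) ` {..<a}"
    have "card ?B' = a" by (subst card_image) (auto simp: inj_on_def)
    moreover have "{1..a} \<subseteq> {1..n}" "?B' \<subseteq> {1..n}" using a by auto
    ultimately obtain h where h: "h \<in> H" "h ` {1..a} = ?B'"
      using homog[of "{1..a}" ?B'] by auto
    have "1 \<in> {1..a}" "2 \<in> {1..a}" using a by auto
    then have "h 1 \<in> ?B'" "h 2 \<in> ?B'" using h(2) by blast+
    then obtain k l where kl: "k < a" "l < a" "h 1 = 2 * k + 1" "h 2 = 2 * l + 1" by auto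
    have "h 1 \<noteq> h 2" using bij[OF h(1)] by (simp add: bij_is_inj inj_eq)
    then have "k \<noteq> l" using kl by auto
    have "5 \<le> n div 2" using False n by presburger
    have idx: "pair_index (h 1) = k" "pair_index (h 2) = l" using kl by (simp_all add: pair_index_def)
    have 12: "(1::nat) \<in> {1..n}" "(2::nat) \<in> {1..n}" "(1::nat) \<noteq> 2" "pair_index 1 = pair_index 2"
      "pair_index 1 < n div 2" using n by (auto simp: pair_index_def)
    have 21: "pair_index (h 2) < n div 2" "pair_index (h 1) \<noteq> pair_index (h 2)"
      using idx kl a \<open>k \<noteq> l\<close> by simp_all
    show ?thesis
      using three_cycle_from_moved_pair[OF h(1) 12 21 disjI1[OF \<open>5 \<le> n div 2\<close>]] that by blast
  qed
  have "2 * a \<le> card {1..n}" using a(2) by simp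
  from homogeneous_with_three_cycle[OF homog a(1) this uwx] show ?thesis .
qed

end

lemma alt_group_subset_if_contains_alt:
  assumes "permutation_group {1..n} H" "permutation_group.contains_alt {1..n} H {1..n}"
  shows "carrier (alt_group n) \<subseteq> H"
proof
  interpret permutation_group "{1..n}" H by fact
  fix p assume "p \<in> carrier (alt_group n)"
  then have gen: "p \<in> generate (alt_group n) (three_cycles n)"
    by (simp add: alt_group_carrier_as_three_cycles)
  have 3: "q \<in> H" if q3: "q \<in> three_cycles n" for q
  proof -
    obtain cs where cs: "q = cycle_of_list cs" "cycle cs" "length cs = 3" "set cs \<subseteq> {1..n}"
      using q3 by blast
    obtain a b c where "cs = [a, b, c]" using stupid_lemma[OF cs(3)] by blast
    then show ?thesis
      using cs contains_altD[OF assms(2), of a b c] by (auto simp: three_cycle_def)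
  qed
  from gen show "p \<in> H"
  proof induction
    case one show ?case unfolding alt_group_one by (rule id_closed)
  next
    case (incl q) then show ?case using 3 by blast
  next
    case (inv q)
    then have "inv\<^bsub>alt_group n\<^esub> q = inv' q"
      using alt_group_inv_equality three_cycles_incl by blast
    then show ?case using inv_closed 3 inv by simp
  next
    case (eng p q) then show ?case unfolding alt_group_mult by (intro comp_closed)
  qed
qed

section \<open>Actions of the alternating group that contain a full cycle\<close>

lemma even_card_fixed_point_free_involution:
  assumes fin: "finite X" and t: "\<And>x. x \<in> X \<Longrightarrow> t x \<in> X \<and> t x \<noteq> x \<and> t (t x) = x"
  shows "even (card X)"
proof -
  let ?C = "(\<lambda>x. {x, t x}) ` X"
  have U: "\<Union> ?C = X" using t by auto
  have "2 dvd card (\<Union> ?C)"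
  proof (rule dvd_partition)
    show "finite (\<Union> ?C)" using U fin by simp
    show "\<forall>c\<in>?C. 2 dvd card c"
    proof
      fix c assume "c \<in> ?C"
      then obtain x where x: "x \<in> X" "c = {x, t x}" by blast
      then have "card c = 2" using t[of x] by auto
      then show "2 dvd card c" by simp
    qed
    show "\<forall>c1\<in>?C. \<forall>c2\<in>?C. c1 \<noteq> c2 \<longrightarrow> c1 \<inter> c2 = {}"
    proof (intro ballI impI)
      have cls: "c = {w, t w}" if c: "c \<in> ?C" "w \<in> c" for c w
      proof -
        obtain x where "x \<in> X" "c = {x, t x}" using c by blast
        then show ?thesis using t[of x] c by auto
      qed
      fix c1 c2 assume "c1 \<in> ?C" "c2 \<in> ?C" "c1 \<noteq> c2"
      then show "c1 \<inter> c2 = {}" using cls by blast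
    qed
  qed
  then show ?thesis by (simp only: U)
qed

text \<open>Each involution preserves the common fixed points of the previous ones and moves the others in pairs, so parity is
preserved at every step.\<close>

lemma odd_card_common_fixed_points:
  assumes "finite T" and X: "finite X" "odd (card X)"
    and T: "\<And>t x. t \<in> T \<Longrightarrow> x \<in> X \<Longrightarrow> t x \<in> X \<and> t (t x) = x"
    and comm: "\<And>s t x. s \<in> T \<Longrightarrow> t \<in> T \<Longrightarrow> x \<in> X \<Longrightarrow> s (t x) = t (s x)"
  shows "odd (card {x \<in> X. \<forall>t\<in>T. t x = x})"
  using assms(1) T comm
proof (induction T)
  case empty
  then show ?case using X by simp
next
  case (insert t T)
  let ?Y = "{x \<in> X. \<forall>s\<in>T. s x = x}"
  have Y: "odd (card ?Y)" by (rule insert.IH) (use insert.prems in auto)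
  have fin: "finite ?Y" using X by simp
  have "even (card {x \<in> ?Y. t x \<noteq> x})"
  proof (rule even_card_fixed_point_free_involution[of _ t])
    fix x assume x: "x \<in> {x \<in> ?Y. t x \<noteq> x}"
    then have tx: "t x \<in> X" "t (t x) = x" using insert.prems(1)[of t x] by auto
    have "s (t x) = t x" if "s \<in> T" for s
      using insert.prems(2)[of s t x] x that by auto
    then show "t x \<in> {x \<in> ?Y. t x \<noteq> x} \<and> t x \<noteq> x \<and> t (t x) = x" using x tx by auto
  qed (rule finite_subset[OF _ fin], blast)
  moreover have "card ?Y = card {x \<in> ?Y. t x \<noteq> x} + card {x \<in> ?Y. t x = x}"
    using X(1) by (subst card_Un_disjoint[symmetric]) (auto intro!: arg_cong[of _ _ card])
  ultimately have "odd (card {x \<in> ?Y. t x = x})" using Y by simp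
  moreover have "{x \<in> ?Y. t x = x} = {x \<in> X. \<forall>s\<in>insert t T. s x = x}" by auto
  ultimately show ?case by simp
qed

lemma exists_permutes_image:
  assumes fin: "finite S" and "A \<subseteq> S" "B \<subseteq> S" "card A = card B"
  obtains g where "g permutes S" "g ` A = B"
proof -
  have finA: "finite A" "finite B" using assms finite_subset by blast+
  obtain f where f: "bij_betw f A B"
    using finite_same_card_bij[OF finA assms(4)] by blast
  have "card (S - A) = card (S - B)" using assms finA by (simp add: card_Diff_subset)
  then obtain f' where f': "bij_betw f' (S - A) (S - B)"
    using finite_same_card_bij[of "S - A" "S - B"] fin by blast
  let ?g = "\<lambda>x. if x \<in> A then f x else if x \<in> S then f' x else x"
  have "bij_betw ?g A B" using f bij_betw_cong[of A ?g f] by simp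
  moreover have "bij_betw ?g (S - A) (S - B)" using f' bij_betw_cong[of "S - A" ?g f'] by simp
  ultimately have "bij_betw ?g (A \<union> (S - A)) (B \<union> (S - B))" by (rule bij_betw_combine) auto
  moreover have "A \<union> (S - A) = S" "B \<union> (S - B) = S" using assms by auto
  ultimately have "?g permutes S" using assms(2) by (intro bij_imp_permutes) auto
  then show ?thesis using that \<open>bij_betw ?g A B\<close> by (simp add: bij_betw_def)
qed

text \<open>An odd permutation with the right image is corrected by a transposition of two points of \<open>B\<close>.\<close>

lemma alt_group_homogeneous:
  assumes "A \<subseteq> {1..n}" "B \<subseteq> {1..n}" "card A = card B" "2 \<le> card B"
  obtains g where "g \<in> carrier (alt_group n)" "g ` A = B"
proof -
  obtain g where g: "g permutes {1..n}" "g ` A = B"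
    using exists_permutes_image[OF _ assms(1,2,3)] by auto
  obtain x y where xy: "x \<in> B" "y \<in> B" "x \<noteq> y" using two_distinct_elements[OF assms(4)] .
  have t: "transpose x y permutes {1..n}" using permutes_swap_id[of x "{1..n}" y] xy assms(2) by blast
  show ?thesis
  proof (cases "evenperm g")
    case True then show ?thesis using that g by (simp add: alt_group_carrier)
  next
    case False
    have "permutation g" "permutation (transpose x y)"
      using g t by (auto intro: permutes_imp_permutation[rotated])
    then have "evenperm (transpose x y \<circ> g)" using False xy by (simp only: evenperm_comp evenperm_swap)
    moreover have "transpose x y \<circ> g permutes {1..n}" using permutes_compose[OF g(1) t] .
    moreover have "(transpose x y \<circ> g) ` A = B" using g(2) xy by (metis image_comp transpose_image_eq)
    ultimately show ?thesis using that[of "transpose x y \<circ> g"] by (simp add: alt_group_carrier)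
  qed
qed

locale alternating_action_with_cycle =
  fixes n N :: nat and act :: "(nat \<Rightarrow> nat) \<Rightarrow> nat \<Rightarrow> nat" and z :: "nat \<Rightarrow> nat" and cs :: "nat list"
  assumes n: "3 \<le> n"
    and act_permutes: "g \<in> carrier (alt_group n) \<Longrightarrow> act g permutes {..<N}"
    and act_comp: "g \<in> carrier (alt_group n) \<Longrightarrow> h \<in> carrier (alt_group n) \<Longrightarrow> act (g \<circ> h) = act g \<circ> act h"
    and act_inj: "inj_on act (carrier (alt_group n))"
    and z: "z \<in> carrier (alt_group n)"
    and cs: "cycle cs" "set cs = {..<N}" "act z = cycle_of_list cs"
begin

abbreviation A where "A \<equiv> carrier (alt_group n)"

lemma A_id: "id \<in> A"
  by (simp add: alt_group_carrier permutes_id)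

lemma A_comp: "g \<in> A \<Longrightarrow> h \<in> A \<Longrightarrow> g \<circ> h \<in> A"
  using evenperm_comp[OF alt_group_carrier' alt_group_carrier', of g n h n]
  by (simp add: alt_group_carrier permutes_compose)

lemma A_permutes: "g \<in> A \<Longrightarrow> g permutes {1..n}"
  by (simp add: alt_group_carrier)

lemma A_funpow: "g \<in> A \<Longrightarrow> g ^^ k \<in> A"
  by (induction k) (use A_id A_comp in \<open>simp_all add: id_def\<close>)

lemma act_id: "act id = id"
proof -
  have "act id \<circ> act id = act id" using act_comp[OF A_id A_id] by simp
  moreover have "bij (act id)" using act_permutes[OF A_id] permutes_bij by blast
  ultimately show ?thesis by (metis bij_is_inj comp_id fun.inj_map_strong inj_iff o_assoc id_comp)
qed

lemma act_funpow: "g \<in> A \<Longrightarrow> act (g ^^ k) = act g ^^ k"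
  by (induction k) (simp_all add: act_id act_comp A_funpow flip: id_def)

lemma act_inv: "g \<in> A \<Longrightarrow> act (inv' g) = inv' (act g)"
proof -
  assume g: "g \<in> A"
  have "act (inv' g) \<circ> act g = id"
    using act_comp[OF alt_group_inv_closed[OF g] g] permutes_inv_o(2)[OF A_permutes[OF g]] act_id by simp
  then show "act (inv' g) = inv' (act g)"
    by (metis act_permutes[OF g] comp_assoc comp_id id_comp permutes_inv_o(1))
qed

lemma length_cs: "length cs = N"
  using distinct_card[OF cs(1)] cs(2) by simp

lemma act_z_funpow_nth:
  assumes "i < N"
  shows "(act z ^^ k) (cs ! i) = cs ! ((k + i) mod N)"
proof -
  have "map (act z ^^ k) cs ! i = rotate k cs ! i" using cyclic_rotation[OF cs(1), of k] cs(3) by simp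
  then show ?thesis using assms length_cs by (simp add: nth_rotate)
qed

lemma act_z_transitive:
  assumes "x < N" "y < N"
  obtains k where "act (z ^^ k) x = y"
proof -
  obtain i j where ij: "i < N" "j < N" "x = cs ! i" "y = cs ! j"
    using assms cs(2) length_cs by (metis in_set_conv_nth lessThan_iff)
  \<comment> \<open>The exponent \<open>j - i\<close>, increased by \<open>N\<close> to keep it nonnegative.\<close>
  have "(act z ^^ (N - i + j)) x = cs ! ((N - i + j + i) mod N)"
    using act_z_funpow_nth ij by simp
  also have "N - i + j + i = N + j" using ij by simp
  finally have "(act z ^^ (N - i + j)) x = y" using ij by simp
  then show ?thesis using that act_funpow[OF z] by metis
qed

text \<open>A faithful action on fewer than \<open>n\<close> points would embed \<open>n! / 2\<close> elements into a group of order at most \<open>(n - 1)!\<close>.\<close>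

lemma degree_le:
  "n \<le> N"
proof (rule ccontr)
  assume "\<not> n \<le> N"
  then have N: "N \<le> n - 1" by simp
  have "card A \<le> card {p. p permutes {..<N}}"
    using act_inj act_permutes by (intro card_inj_on_le[of act]) (auto simp: finite_permutations)
  also have "\<dots> = fact N" by (rule card_permutations) auto
  also have "fact N \<le> (fact (n - 1) :: nat)" using N by (rule fact_mono)
  finally have "fact n \<le> 2 * (fact (n - 1) :: nat)" using alt_group_card_carrier[of n] n by simp
  moreover have "(fact n :: nat) = n * fact (n - 1)" using n by (simp add: fact_reduce)
  ultimately have "n * fact (n - 1) \<le> 2 * (fact (n - 1) :: nat)" by simp
  then have "n \<le> 2" using fact_gt_zero[of "n - 1", where 'a = nat] by (metis mult_le_cancel2)
  then show False using n by simp
qed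

lemma order_z:
  shows "z ^^ N = id" and "0 < k \<Longrightarrow> z ^^ k = id \<Longrightarrow> N \<le> k"
proof -
  have N: "0 < N" using degree_le n by simp
  have "act (z ^^ N) x = x" for x
  proof (cases "x < N")
    case True
    then obtain i where "i < N" "x = cs ! i" using cs(2) length_cs by (metis in_set_conv_nth lessThan_iff)
    then show ?thesis using act_z_funpow_nth[of i N] act_funpow[OF z] by simp
  next
    case False
    then show ?thesis using permutes_not_in[OF act_permutes[OF A_funpow[OF z]]] by simp
  qed
  then have "act (z ^^ N) = act id" using act_id by (simp add: fun_eq_iff)
  then show "z ^^ N = id" using act_inj A_funpow[OF z] A_id by (meson inj_onD)
  assume k: "0 < k" "z ^^ k = id"
  then have "act z ^^ k = id" using act_funpow[OF z, of k] act_id by simp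
  then have "cs ! (k mod N) = cs ! 0" using act_z_funpow_nth[OF N, of k] by simp
  then have "k mod N = 0" using cs(1) length_cs N by (simp add: nth_eq_iff_index_eq)
  then show "N \<le> k" using k by (auto dest: dvd_imp_le)
qed

text \<open>Three-cycles generate the group and are squares.\<close>

lemma act_even: "g \<in> A \<Longrightarrow> evenperm (act g)"
proof -
  assume "g \<in> A"
  then have gen: "g \<in> generate (alt_group n) (three_cycles n)"
    using alt_group_carrier_as_three_cycles by blast
  have perm: "permutation (act h)" if "h \<in> A" for h
    using act_permutes[OF that] permutes_imp_permutation by blast
  have 3: "evenperm (act q)" if q3: "q \<in> three_cycles n" for q
  proof -
    obtain xs where xs: "q = cycle_of_list xs" "cycle xs" "length xs = 3" "set xs \<subseteq> {1..n}"
      using q3 by blast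
    obtain a b c where abc: "xs = [a, b, c]" using stupid_lemma[OF xs(3)] by blast
    have q: "q = three_cycle a b c" using xs abc by (simp add: three_cycle_def)
    have "cycle_of_list [c, b, a] \<in> three_cycles n"
      using xs abc by (intro CollectI exI[of _ "[c, b, a]"]) auto
    then have "cycle_of_list [c, b, a] \<in> A" using three_cycles_incl by blast
    then have r: "three_cycle c b a \<in> A" by (simp add: three_cycle_def)
    have "q = three_cycle c b a \<circ> three_cycle c b a"
      using q xs abc three_cycle_square[of c b a] by auto
    then show ?thesis using act_comp[OF r r] evenperm_comp[OF perm[OF r] perm[OF r]] by simp
  qed
  from gen show "evenperm (act g)"
  proof induction
    case one then show ?case unfolding alt_group_one act_id by simp
  next
    case (incl q) then show ?case using 3 by blast
  next
    case (inv q)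
    then have q: "q \<in> A" using three_cycles_incl by blast
    then have "act (inv\<^bsub>alt_group n\<^esub> q) = inv' (act q)"
      using alt_group_inv_equality[OF q] act_inv[OF q] by simp
    then show ?case using evenperm_inv[OF perm[OF q]] 3[OF inv] by simp
  next
    case (eng p q)
    then have pq: "p \<in> A" "q \<in> A" using alt_group_carrier_as_three_cycles by blast+
    show ?case unfolding alt_group_mult act_comp[OF pq] evenperm_comp[OF perm perm, OF pq]
      using eng.IH by simp
  qed
qed

lemma odd_N: "odd N"
proof -
  have "even (N - 1)"
    using act_even[OF z] cs swapidseq_ext_imp_swapidseq[OF swapidseq_ext_of_cycles[OF cs(1)]] length_cs
      evenperm_unique by metis
  then show ?thesis using degree_le n by simp
qed

end

section \<open>The degree of the action\<close>

context alternating_action_with_cycle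
begin

lemma pair_swap_even:
  assumes "k < n div 2" "l < n div 2" "k \<noteq> l"
  shows "pair_swap k \<circ> pair_swap l \<in> A"
proof -
  have p: "pair_swap i permutes {1..n}" if "i < n div 2" for i
    unfolding pair_swap_def using that by (intro permutes_swap_id) auto
  then have "permutation (pair_swap k)" "permutation (pair_swap l)"
    using assms permutes_imp_permutation by blast+
  then have "evenperm (pair_swap k \<circ> pair_swap l)"
    by (simp add: evenperm_comp) (simp add: pair_swap_def evenperm_swap)
  then show ?thesis using permutes_compose[OF p[OF assms(2)] p[OF assms(1)]] by (simp add: alt_group_carrier)
qed

lemma pair_swap_commute: "pair_swap k \<circ> pair_swap l = pair_swap l \<circ> pair_swap k"
proof (cases "k = l")
  case False
  have "(pair_swap k \<circ> pair_swap l) x = (pair_swap l \<circ> pair_swap k) x" for x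
    using False unfolding pair_swap_def comp_def transpose_def by (auto; presburger)
  then show ?thesis by blast
qed simp

lemma pair_swap_involution: "pair_swap k \<circ> pair_swap k = id"
  by (simp add: pair_swap_def)

text \<open>The number of points is odd, so the products of two transpositions along the matching, which are commuting
involutions, fix a common point.\<close>

lemma common_fixed_point:
  obtains \<omega> where "\<omega> < N"
    "\<And>k l. k < n div 2 \<Longrightarrow> l < n div 2 \<Longrightarrow> k \<noteq> l \<Longrightarrow> act (pair_swap k \<circ> pair_swap l) \<omega> = \<omega>"
proof -
  let ?P = "{(k, l). k < n div 2 \<and> l < n div 2 \<and> k \<noteq> l}"
  let ?e = "\<lambda>(k, l). pair_swap k \<circ> pair_swap l"
  have fin: "finite ?P" by (rule finite_subset[of _ "{..<n div 2} \<times> {..<n div 2}"]) auto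
  have mem: "?e q \<in> A" if "q \<in> ?P" for q using that pair_swap_even by auto
  have comm: "?e q \<circ> ?e r = ?e r \<circ> ?e q" for q r
  proof -
    obtain k l i j where "q = (k, l)" "r = (i, j)" by fastforce
    then show ?thesis by simp (metis (no_types, lifting) o_assoc pair_swap_commute)
  qed
  have sq: "?e q \<circ> ?e q = id" for q
  proof -
    obtain k l where "q = (k, l)" by fastforce
    then show ?thesis
      by simp (metis (no_types, lifting) comp_id o_assoc pair_swap_commute pair_swap_involution)
  qed
  have "odd (card {x \<in> {..<N}. \<forall>t\<in>(act \<circ> ?e) ` ?P. t x = x})"
  proof (rule odd_card_common_fixed_points)
    show "finite ((act \<circ> ?e) ` ?P)" using fin by blast
    show "odd (card {..<N})" using odd_N by simp
  next
    fix t x assume "t \<in> (act \<circ> ?e) ` ?P" "x \<in> {..<N}"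
    then obtain q where q: "q \<in> ?P" "t = act (?e q)" by auto
    have "act (?e q) \<circ> act (?e q) = id"
      using act_comp[OF mem[OF q(1)] mem[OF q(1)]] by (simp only: sq act_id)
    then show "t x \<in> {..<N} \<and> t (t x) = x"
      using permutes_in_image[OF act_permutes[OF mem[OF q(1)]]] \<open>x \<in> _\<close> q by (metis comp_apply id_apply)
  next
    fix s t x assume "s \<in> (act \<circ> ?e) ` ?P" "t \<in> (act \<circ> ?e) ` ?P"
    then obtain q r where q: "q \<in> ?P" "s = act (?e q)" "r \<in> ?P" "t = act (?e r)" by auto
    have "s \<circ> t = t \<circ> s"
      unfolding q(2,4) act_comp[OF mem[OF q(1)] mem[OF q(3)], symmetric]
        act_comp[OF mem[OF q(3)] mem[OF q(1)], symmetric] comm[of q r] ..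
    then show "s (t x) = t (s x)" by (metis comp_apply)
  qed simp
  then have "{x \<in> {..<N}. \<forall>t\<in>(act \<circ> ?e) ` ?P. t x = x} \<noteq> {}" by (metis card.empty even_zero)
  then obtain \<omega> where "\<omega> \<in> {..<N}" "\<forall>t\<in>(act \<circ> ?e) ` ?P. t \<omega> = \<omega>" by blast
  then show ?thesis using that[of \<omega>] by force
qed

definition stabilizer :: "nat \<Rightarrow> (nat \<Rightarrow> nat) set" where
  "stabilizer \<omega> = {g \<in> A. act g \<omega> = \<omega>}"

lemma stabilizer_group: "permutation_group {1..n} (stabilizer \<omega>)"
proof
  show "h permutes {1..n}" if "h \<in> stabilizer \<omega>" for h
    using that A_permutes by (simp add: stabilizer_def)
  show "id \<in> stabilizer \<omega>" using A_id act_id by (simp add: stabilizer_def)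
  show "g \<circ> h \<in> stabilizer \<omega>" if "g \<in> stabilizer \<omega>" "h \<in> stabilizer \<omega>" for g h
    using that A_comp act_comp by (simp add: stabilizer_def)
  show "inv' h \<in> stabilizer \<omega>" if h: "h \<in> stabilizer \<omega>" for h
  proof -
    have hA: "h \<in> A" "act h \<omega> = \<omega>" using h by (auto simp: stabilizer_def)
    then have "inv' (act h) \<omega> = \<omega>"
      using permutes_inverses(2)[OF act_permutes[OF hA(1)], of \<omega>] by simp
    then show ?thesis using act_inv alt_group_inv_closed hA by (simp add: stabilizer_def)
  qed
qed simp

text \<open>Choose an even permutation \<open>g\<close> that carries \<open>B\<close> to \<open>S\<close>. Some power of \<open>z\<close> takes the image of \<open>\<omega>\<close> under \<open>g\<close>
back to \<open>\<omega>\<close>; multiplying by it leads into the stabilizer and does not change the image, as \<open>z\<close> preserves \<open>S\<close>.\<close>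

lemma stabilizer_homogeneous:
  assumes \<omega>: "\<omega> < N" and S: "S \<subseteq> {1..n}" "z ` S = S" "2 \<le> card S"
    and B: "B \<subseteq> {1..n}" "B' \<subseteq> {1..n}" "card B = card S" "card B' = card S"
  shows "\<exists>h\<in>stabilizer \<omega>. h ` B = B'"
proof -
  interpret H: permutation_group "{1..n}" "stabilizer \<omega>" by (rule stabilizer_group)
  have to_S: "\<exists>h\<in>stabilizer \<omega>. h ` B = S" if B: "B \<subseteq> {1..n}" "card B = card S" for B
  proof -
    obtain g where g: "g \<in> A" "g ` B = S"
      using alt_group_homogeneous[OF B(1) S(1) B(2) S(3)] .
    have "act g \<omega> < N" using permutes_in_image[OF act_permutes[OF g(1)]] \<omega> by simp
    then obtain k where k: "act (z ^^ k) (act g \<omega>) = \<omega>" using act_z_transitive \<omega> by blast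
    have "(z ^^ k) ` S = S" 
    proof (induction k)
      case (Suc k) then show ?case by (simp only: funpow.simps image_comp[symmetric] S(2))
    qed simp
    then have "(z ^^ k \<circ> g) ` B = S" using g by (metis image_comp)
    moreover have "z ^^ k \<circ> g \<in> stabilizer \<omega>"
      using k act_comp[OF A_funpow[OF z] g(1)] A_comp[OF A_funpow[OF z] g(1)] by (simp add: stabilizer_def)
    ultimately show ?thesis by blast
  qed
  obtain h h' where h: "h \<in> stabilizer \<omega>" "h ` B = S" "h' \<in> stabilizer \<omega>" "h' ` B' = S"
    using to_S[OF B(1,3)] to_S[OF B(2,4)] by blast
  have "inv' h' ` S = B'" using H.bij[OF h(3)] h(4) by (metis bij_is_inj image_inv_f_f)
  then have "(inv' h' \<circ> h) ` B = B'" using h by (metis image_comp)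
  then show ?thesis using H.comp_closed H.inv_closed h by blast
qed

text \<open>If an orbit of \<open>z\<close> on \<open>{1..n}\<close> missed at most one point, then the power of \<open>z\<close> that fixes this orbit pointwise would be the
identity, and the order \<open>N\<close> of \<open>z\<close> would be at most \<open>n\<close>.\<close>

lemma short_orbits:
  assumes N: "n < N" and i: "i \<in> {1..n}"
  shows "least_power z i \<le> n - 2"
proof (rule ccontr)
  let ?l = "least_power z i" and ?O = "set (support z i)"
  assume "\<not> ?l \<le> n - 2"
  then have l: "n - 1 \<le> ?l" by simp
  have perm: "permutation z" using alt_group_carrier'[OF z] .
  have sub: "?O \<subseteq> {1..n}" using permutes_in_image[OF A_permutes[OF A_funpow[OF z]]] i by auto
  have card: "card ?O = ?l" using distinct_card[OF cycle_of_permutation[OF perm]] by simp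
  then have le: "?l \<le> n" using card_mono[OF _ sub] by simp
  have fix_O: "(z ^^ ?l) j = j" if j: "j \<in> ?O" for j
  proof -
    obtain k where k: "j = (z ^^ k) i" using j by auto
    have "(z ^^ ?l) ((z ^^ k) i) = (z ^^ k) ((z ^^ ?l) i)"
      by (metis add.commute comp_apply funpow_add)
    then show ?thesis using k least_power_of_permutation(1)[OF perm] by simp
  qed
  have perm_l: "z ^^ ?l permutes {1..n}" using A_permutes[OF A_funpow[OF z]] .
  have "z ^^ ?l = id"
  proof (rule ccontr)
    assume "z ^^ ?l \<noteq> id"
    then obtain j where j: "(z ^^ ?l) j \<noteq> j" by (auto simp: fun_eq_iff)
    then have "j \<in> {1..n}" "j \<notin> ?O" using fix_O permutes_not_in[OF perm_l] by blast+
    moreover have "(z ^^ ?l) j \<in> {1..n}" "(z ^^ ?l) j \<notin> ?O"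
    proof -
      show "(z ^^ ?l) j \<in> {1..n}" using permutes_in_image[OF perm_l] \<open>j \<in> {1..n}\<close> by blast
      show "(z ^^ ?l) j \<notin> ?O"
        using fix_O j permutes_inj[OF perm_l] by (metis injD)
    qed
    ultimately have "card ({j, (z ^^ ?l) j} \<union> ?O) \<le> n"
      using sub card_mono[of "{1..n}" "{j, (z ^^ ?l) j} \<union> ?O"] by auto
    moreover have "card ({j, (z ^^ ?l) j} \<union> ?O) = 2 + ?l"
      using card j \<open>j \<notin> ?O\<close> \<open>(z ^^ ?l) j \<notin> ?O\<close> by (subst card_Un_disjoint) auto
    ultimately show False using l by simp
  qed
  then have "N \<le> ?l" using order_z(2) least_power_of_permutation(2)[OF perm] by blast
  then show False using le N by simp
qed

text \<open>The orbit lengths divide the order \<open>N\<close> of \<open>z\<close> and are therefore odd.\<close>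

lemma orbit_facts:
  assumes "i \<in> {1..n}"
  shows "set (support z i) \<subseteq> {1..n}" "card (set (support z i)) = least_power z i"
    "z ` set (support z i) = set (support z i)" "odd (least_power z i)"
proof -
  have perm: "permutation z" using alt_group_carrier'[OF z] .
  show sub: "set (support z i) \<subseteq> {1..n}"
    using permutes_in_image[OF A_permutes[OF A_funpow[OF z]]] assms by auto
  show card: "card (set (support z i)) = least_power z i"
    using distinct_card[OF cycle_of_permutation[OF perm]] by simp
  have "z ` set (support z i) \<subseteq> set (support z i)"
    unfolding support_set[OF perm] by (auto intro!: image_eqI[of _ _ "Suc _"])
  then show "z ` set (support z i) = set (support z i)"
    using endo_inj_surj[of "set (support z i)" z] permutes_inj_on[OF A_permutes[OF z]] by blast
  have "least_power z i dvd N" using order_z(1) least_power_minimal[of N z i] by simp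
  then show "odd (least_power z i)" using odd_N by (meson dvd_trans)
qed

text \<open>A nontrivial orbit of \<open>z\<close> or its complement is small enough.\<close>

lemma invariant_set:
  assumes N: "n < N"
  obtains S where "S \<subseteq> {1..n}" "z ` S = S" "2 \<le> card S" "2 * card S \<le> n"
proof -
  have perm: "permutation z" using alt_group_carrier'[OF z] .
  have "z \<noteq> id" using order_z(2)[of 1] N n by auto
  then obtain i where i: "z i \<noteq> i" by (auto simp: fun_eq_iff)
  then have iO: "i \<in> {1..n}" using permutes_not_in[OF A_permutes[OF z]] by blast
  let ?O = "set (support z i)"
  have ge: "2 \<le> card ?O" using least_power_gt_one[OF perm i] orbit_facts(2)[OF iO] by simp
  have le: "card ?O \<le> n - 2" using short_orbits[OF N iO] orbit_facts(2)[OF iO] by simp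
  show ?thesis
  proof (cases "2 * card ?O \<le> n")
    case True then show ?thesis using that[of ?O] orbit_facts[OF iO] ge by blast
  next
    case False
    have c: "card ({1..n} - ?O) = n - card ?O"
      using orbit_facts(1)[OF iO] by (simp add: card_Diff_subset)
    have "z ` ({1..n} - ?O) = {1..n} - ?O"
      using image_set_diff[OF permutes_inj[OF A_permutes[OF z]]] permutes_image[OF A_permutes[OF z]]
        orbit_facts(3)[OF iO] by simp
    then show ?thesis using that[of "{1..n} - ?O"] c False le n by auto
  qed
qed

text \<open>The orbits of \<open>z\<close> have odd length at most \<open>n - 2\<close>, so length 1, 3 or 5. An orbit of length 5
forces \<open>n = 7\<close> and leaves room for two further points only, so that \<open>z\<close> has order 5; without such an orbit \<open>z\<close> has order at
most 3. Both contradict \<open>N > n\<close>.\<close>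

lemma small_degree:
  assumes "n \<le> 7"
  shows "N = n"
proof (rule ccontr)
  assume "N \<noteq> n"
  then have N: "n < N" using degree_le by simp
  have perm: "permutation z" using alt_group_carrier'[OF z] .
  have order: "N \<le> k" if "0 < k" "\<And>j. j \<in> {1..n} \<Longrightarrow> least_power z j dvd k" for k
  proof -
    have "(z ^^ k) j = j" for j
      using that(2)[of j] least_power_dvd[OF perm, of j k] permutes_not_in[OF A_permutes[OF A_funpow[OF z]]]
      by blast
    then show ?thesis using order_z(2)[OF that(1)] by (simp add: fun_eq_iff)
  qed
  have le5: "least_power z j \<le> 5" if "j \<in> {1..n}" for j
    using short_orbits[OF N that] assms by simp
  have vals: "least_power z j = 1 \<or> least_power z j = 3 \<or> least_power z j = 5" if "j \<in> {1..n}" for j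
  proof -
    have "m = 1 \<or> m = 3 \<or> m = 5" if "m \<le> 5" "odd m" for m :: nat using that by presburger
    then show ?thesis using le5[OF that] orbit_facts(4)[OF that] by blast
  qed
  show False
  proof (cases "\<exists>i\<in>{1..n}. least_power z i = 5")
    case False
    have "least_power z j dvd 3" if "j \<in> {1..n}" for j using vals[OF that] False that by auto
    then show False using order[of 3] N n by simp
  next
    case True
    then obtain i where i: "i \<in> {1..n}" "least_power z i = 5" by blast
    have n7: "n = 7" using short_orbits[OF N i(1)] i(2) assms by simp
    have "least_power z j dvd 5" if j: "j \<in> {1..n}" for j
    proof (cases "j \<in> set (support z i)")
      case True
      then obtain k where k: "j = (z ^^ k) i" by auto
      have "(z ^^ 5) ((z ^^ k) i) = (z ^^ k) ((z ^^ 5) i)"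
        by (metis add.commute comp_apply funpow_add)
      then have "(z ^^ 5) j = j" using k i least_power_of_permutation(1)[OF perm, of i] by simp
      then show ?thesis by (rule least_power_minimal)
    next
      case False
      have disj: "set (support z i) \<inter> set (support z j) = {}"
      proof (rule ccontr)
        assume "set (support z i) \<inter> set (support z j) \<noteq> {}"
        then have "set (support z i) = set (support z j)"
          using disjoint_support[OF perm] unfolding disjoint_def by blast
        moreover have "j \<in> set (support z j)" unfolding support_set[OF perm] by (auto intro: range_eqI[of _ _ 0])
        ultimately show False using False by blast
      qed
      have "card (set (support z i) \<union> set (support z j))
          = card (set (support z i)) + card (set (support z j))"
        by (rule card_Un_disjoint[OF _ _ disj]) simp_all
      also have "\<dots> = 5 + least_power z j"
        using orbit_facts(2)[OF i(1)] orbit_facts(2)[OF j] i(2) by argo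
      finally have "card (set (support z i) \<union> set (support z j)) = 5 + least_power z j" .
      moreover have "card (set (support z i) \<union> set (support z j)) \<le> card {1..n}"
        using orbit_facts(1)[OF i(1)] orbit_facts(1)[OF j] by (intro card_mono Un_least) simp_all
      ultimately have "least_power z j \<le> 2" using n7 by simp
      then have "least_power z j = 1" using vals[OF j] by auto
      then show ?thesis by simp
    qed
    then show False using order[of 5] N n7 by simp
  qed
qed

text \<open>The stabilizer of the common fixed point would be the whole group, which is transitive.\<close>

theorem degree_eq:
  assumes "n \<noteq> 8"
  shows "N = n"
proof (rule ccontr)
  assume ne: "N \<noteq> n"
  then have N: "n < N" using degree_le by simp
  have n9: "9 \<le> n" using ne small_degree assms by linarith
  obtain \<omega> where \<omega>: "\<omega> < N"
    "\<And>k l. k < n div 2 \<Longrightarrow> l < n div 2 \<Longrightarrow> k \<noteq> l \<Longrightarrow> act (pair_swap k \<circ> pair_swap l) \<omega> = \<omega>"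
    using common_fixed_point by blast
  obtain S where S: "S \<subseteq> {1..n}" "z ` S = S" "2 \<le> card S" "2 * card S \<le> n"
    using invariant_set[OF N] .
  interpret H: permutation_group_with_matching n "stabilizer \<omega>"
    by (intro permutation_group_with_matching.intro permutation_group_with_matching_axioms.intro
        stabilizer_group) (simp add: stabilizer_def \<omega> pair_swap_even)
  have "H.contains_alt {1..n}"
    by (rule H.homogeneous_contains_alt[OF stabilizer_homogeneous[OF \<omega>(1) S(1,2,3)] S(3,4) n9])
  then have sub: "A \<subseteq> stabilizer \<omega>"
    using alt_group_subset_if_contains_alt[OF stabilizer_group] by blast
  define y where "y = (if \<omega> = 0 then 1 else 0 :: nat)"
  have "y < N" "y \<noteq> \<omega>" using N n by (auto simp: y_def)
  then obtain k where "act (z ^^ k) \<omega> = y" using act_z_transitive \<omega>(1) by blast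
  moreover have "act (z ^^ k) \<omega> = \<omega>" using sub A_funpow[OF z] by (auto simp: stabilizer_def)
  ultimately show False using \<open>y \<noteq> \<omega>\<close> by simp
qed

end

section \<open>Codes with a large automorphism group\<close>

lemma code_aut_carrier:
  "p \<in> carrier (code_aut N C) \<longleftrightarrow> p permutes {..<N} \<and> (\<forall>v\<in>C. permute_coords p v \<in> C)"
  by (auto simp: code_aut_def coord_sym_def)

lemma group_code_aut: "binary_linear_code N C \<Longrightarrow> group (code_aut N C)"
  using subgroup.subgroup_is_group[OF subgroup_code_aut group_coord_sym]
  by (simp add: code_aut_def)

lemma mult_code_aut [simp]: "mult (code_aut N C) = (\<circ>)"
  by (simp add: code_aut_def coord_sym_def)

text \<open>Among the bits at \<open>i\<close>, \<open>j\<close> and \<open>k\<close> two agree. If those at \<open>i\<close> and \<open>j\<close> do, the transposition has no effect; otherwise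
\<open>k\<close> carries the same bit as one of them, and rotating the three positions has the same effect as swapping two.\<close>

lemma permute_transpose_as_three_cycle:
  assumes ij: "i < N" "j < N" "k < N" "distinct [i, j, k]" and v: "v \<in> carrier_vec N"
  shows "permute_coords (transpose i j) v \<in>
    {v, permute_coords (three_cycle i j k) v, permute_coords (three_cycle k j i) v}"
proof -
  have neq: "i \<noteq> j" "i \<noteq> k" "j \<noteq> k" "j \<noteq> i" "k \<noteq> i" "k \<noteq> j" using ij by auto
  have inv3: "inv' (three_cycle a b c) = three_cycle c b a" if "distinct [a, b, c]" for a b c :: nat
    by (rule inv_unique_comp) (use that in \<open>auto simp: fun_eq_iff three_cycle_apply\<close>)
  have bits: "v $ i = v $ j \<or> v $ k = v $ i \<or> v $ k = v $ j"
    by (metis bit.exhaust)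
  have inv: "inv' (three_cycle i j k) = three_cycle k j i" "inv' (three_cycle k j i) = three_cycle i j k"
    using inv3[of i j k] inv3[of k j i] neq by auto
  consider "v $ i = v $ j" | "v $ k = v $ i" | "v $ k = v $ j" using bits by blast
  then show ?thesis
  proof cases
    case 1
    have "permute_coords (transpose i j) v = v"
      unfolding permute_coords_def using v ij 1 by (intro eq_vecI) (auto simp: transpose_def)
    then show ?thesis by simp
  next
    case 2
    have "permute_coords (transpose i j) v = permute_coords (three_cycle k j i) v"
      unfolding permute_coords_def inv
      using v ij 2 neq by (intro eq_vecI) (auto simp: transpose_def three_cycle_apply)
    then show ?thesis by simp
  next
    case 3
    have "permute_coords (transpose i j) v = permute_coords (three_cycle i j k) v"
      unfolding permute_coords_def inv
      using v ij 3 neq by (intro eq_vecI) (auto simp: transpose_def three_cycle_apply)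
    then show ?thesis by simp
  qed
qed

lemma code_aut_all_if_three_cycles:
  assumes C: "binary_linear_code N C" and N: "3 \<le> N"
    and three: "\<And>a b c. a < N \<Longrightarrow> b < N \<Longrightarrow> c < N \<Longrightarrow> distinct [a, b, c]
      \<Longrightarrow> three_cycle a b c \<in> carrier (code_aut N C)"
    and p: "p permutes {..<N}"
  shows "p \<in> carrier (code_aut N C)"
proof -
  interpret G: group "code_aut N C" by (rule group_code_aut[OF C])
  have trans: "transpose a b \<in> carrier (code_aut N C)" if ab: "a < N" "b < N" "a \<noteq> b" for a b
  proof -
    have "card {a, b} < N" using N by (simp add: card_insert_if)
    then obtain k where k: "k < N" "k \<notin> {a, b}" using exists_less_notin[of "{a, b}"] by blast
    have "permute_coords (transpose a b) v \<in> C" if v: "v \<in> C" for v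
    proof -
      have "v \<in> carrier_vec N" using binary_linear_code_carrier[OF C] v by blast
      moreover have "three_cycle a b k \<in> carrier (code_aut N C)" "three_cycle k b a \<in> carrier (code_aut N C)"
        using three ab k by auto
      ultimately have "permute_coords (transpose a b) v \<in>
          {v, permute_coords (three_cycle a b k) v, permute_coords (three_cycle k b a) v}"
          "{v, permute_coords (three_cycle a b k) v, permute_coords (three_cycle k b a) v} \<subseteq> C"
        using permute_transpose_as_three_cycle[OF ab(1,2) k(1)] ab k v
        unfolding code_aut_carrier by auto
      then show ?thesis by blast
    qed
    then show ?thesis unfolding code_aut_carrier using ab permutes_swap_id[of a "{..<N}" b] by auto
  qed
  from p finite_lessThan show ?thesis
  proof (induction rule: permutes_induct)
    case id
    show ?case unfolding code_aut_carrier permute_coords_id using permutes_id by blast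
  next
    case (swap a b p)
    then have "transpose a b \<otimes>\<^bsub>code_aut N C\<^esub> p \<in> carrier (code_aut N C)"
      by (intro G.m_closed trans) auto
    then show ?case by (simp only: mult_code_aut)
  qed
qed

text \<open>The square of any element outside a subgroup of index two lies inside, since \<open>x \<circ> x\<close> in the coset of \<open>x\<close> would force \<open>x\<close>
into the subgroup. A three-cycle is the square of its inverse.\<close>

lemma index_two_contains_three_cycles:
  assumes C: "binary_linear_code N C" and card: "2 * card (carrier (code_aut N C)) = fact N"
    and abc: "a < N" "b < N" "c < N" "distinct [a, b, c]"
  shows "three_cycle a b c \<in> carrier (code_aut N C)"
proof (rule ccontr)
  let ?G = "carrier (code_aut N C)" and ?x = "three_cycle a b c"
  interpret G: group "code_aut N C" by (rule group_code_aut[OF C])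
  assume x: "?x \<notin> ?G"
  have xp: "?x permutes {..<N}"
    unfolding three_cycle_def using abc by (intro permutes_compose permutes_swap_id) auto
  have inj: "inj ?x" using permutes_inj[OF xp] .
  have G_sub: "?G \<subseteq> {p. p permutes {..<N}}" by (auto simp: code_aut_carrier)
  have fin: "finite {p. p permutes {..<N}}" by (simp add: finite_permutations)
  have cancel: "p \<in> ?G" if "p permutes {..<N}" "q \<in> ?G" "p \<circ> q \<in> ?G" for p q
  proof -
    let ?q' = "inv\<^bsub>code_aut N C\<^esub> q"
    have "q \<circ> ?q' = id"
      using G.r_inv[OF that(2)] by (simp add: code_aut_def coord_sym_def)
    then have "p = (p \<circ> q) \<circ> ?q'" by (simp add: o_assoc[symmetric])
    then show ?thesis using G.m_closed[OF that(3) G.inv_closed[OF that(2)]] by simp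
  qed
  let ?xG = "(\<lambda>g. ?x \<circ> g) ` ?G"
  have disj: "?G \<inter> ?xG = {}" using cancel[OF xp] x by blast
  have sub: "?xG \<subseteq> {p. p permutes {..<N}}" using xp G_sub permutes_compose by blast
  have cardx: "card ?xG = card ?G"
    by (intro card_image inj_onI) (use inj in \<open>auto simp: fun_eq_iff inj_eq\<close>)
  have "card (?G \<union> ?xG) = fact N"
    using card card_Un_disjoint[OF _ _ disj] fin finite_subset[OF G_sub] finite_subset[OF sub] cardx by simp
  then have all: "?G \<union> ?xG = {p. p permutes {..<N}}"
    using G_sub sub fin card_permutations[of "{..<N}" N] by (intro card_subset_eq) auto
  have x2: "?x \<circ> ?x = three_cycle c b a" using abc(4) by (rule three_cycle_square)
  have x3: "?x \<circ> three_cycle c b a = id" "three_cycle c b a \<circ> ?x = id"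
    using abc(4) by (auto simp: fun_eq_iff three_cycle_apply)
  have "?x \<circ> ?x \<in> ?G"
  proof (rule ccontr)
    assume "?x \<circ> ?x \<notin> ?G"
    then obtain g where g: "g \<in> ?G" "?x \<circ> ?x = ?x \<circ> g" using all permutes_compose[OF xp xp] by blast
    then have "?x = g" using inj by (auto simp: fun_eq_iff inj_eq)
    then show False using g x by simp
  qed
  then have "three_cycle c b a \<circ> three_cycle c b a \<in> ?G" using x2 G.m_closed by force
  moreover have "three_cycle c b a \<circ> three_cycle c b a = ?x"
    using abc(4) three_cycle_square[of c b a] by auto
  ultimately show False using x by simp
qed

theorem code_aut_not_alternating:
  assumes cyc: "binary_cyclic_code N C" and three: "3 \<le> n" and not8: "n \<noteq> 8"
  shows "\<not> code_aut N C \<cong> alt_group n"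
proof
  assume iso: "code_aut N C \<cong> alt_group n"
  have C: "binary_linear_code N C" using cyc by (simp add: binary_cyclic_code_def)
  obtain cs where cs: "cycle cs" "set cs = {..<N}" "cycle_of_list cs \<in> carrier (code_aut N C)"
    using cyc by (auto simp: binary_cyclic_code_def)
  have "alt_group n \<cong> code_aut N C" using group.iso_sym[OF group_code_aut[OF C] iso] .
  then obtain act where act: "act \<in> iso (alt_group n) (code_aut N C)" unfolding is_iso_def by blast
  then have bij: "bij_betw act (carrier (alt_group n)) (carrier (code_aut N C))"
    and hom: "act \<in> hom (alt_group n) (code_aut N C)" by (auto simp: iso_def)
  obtain z where z: "z \<in> carrier (alt_group n)" "act z = cycle_of_list cs"
    using bij cs(3) by (metis bij_betw_imp_surj_on imageE)
  interpret alternating_action_with_cycle n N act z cs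
  proof
    show "act g permutes {..<N}" if "g \<in> carrier (alt_group n)" for g
      using bij_betwE[OF bij] that by (auto simp: code_aut_carrier)
    show "act (g \<circ> h) = act g \<circ> act h" if "g \<in> carrier (alt_group n)" "h \<in> carrier (alt_group n)" for g h
      using hom_mult[OF hom that] by (simp add: alt_group_mult)
  qed (use three cs z bij in \<open>auto simp: bij_betw_def\<close>)
  have N: "N = n" using degree_eq[OF not8] .
  have card: "2 * card (carrier (code_aut N C)) = fact N"
    using bij_betw_same_card[OF bij] alt_group_card_carrier[of n] three N by simp
  have "{p. p permutes {..<N}} \<subseteq> carrier (code_aut N C)"
    using code_aut_all_if_three_cycles[OF C _ index_two_contains_three_cycles[OF C card]] three N by blast
  moreover have "finite (carrier (code_aut N C))"
    using card by (metis card.infinite fact_nonzero mult_0_right)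
  ultimately have "card {p. p permutes {..<N}} \<le> card (carrier (code_aut N C))" by (intro card_mono)
  then have "fact N \<le> card (carrier (code_aut N C))" using card_permutations[of "{..<N}" N] by simp
  then show False using card fact_gt_zero[of N, where 'a = nat] by linarith
qed

section \<open>Affine structures on eight points\<close>

text \<open>Subsets of \<open>{1..8}\<close> are encoded as tuples of bits, so that the permutations needed below act on them by
rearranging a tuple, which rewriting can evaluate.\<close>

type_synonym mask = "bool \<times> bool \<times> bool \<times> bool \<times> bool \<times> bool \<times> bool \<times> bool"

definition subset_of_mask :: "mask \<Rightarrow> nat set" where
  "subset_of_mask = (\<lambda>(a, b, c, d, e, f, g, h).
     (if a then {1} else {}) \<union> (if b then {2} else {}) \<union> (if c then {3} else {}) \<union> (if d then {4} else {}) \<union>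
     (if e then {5} else {}) \<union> (if f then {6} else {}) \<union> (if g then {7} else {}) \<union> (if h then {8} else {}))"

definition mask_list :: "mask \<Rightarrow> bool list" where
  "mask_list = (\<lambda>(a, b, c, d, e, f, g, h). [a, b, c, d, e, f, g, h])"

text \<open>A permutation of order 15; it will act on the fifteen structures as a cycle.\<close>

definition zeta :: "nat \<Rightarrow> nat" where
  "zeta = cycle_of_list [1, 2, 3, 4, 5] \<circ> cycle_of_list [6, 7, 8]"

definition zeta_mask :: "mask \<Rightarrow> mask" where
  "zeta_mask = (\<lambda>(a, b, c, d, e, f, g, h). (e, a, b, c, d, h, f, g))"

definition three_cycle_mask :: "mask \<Rightarrow> mask" where
  "three_cycle_mask = (\<lambda>(a, b, c, d, e, f, g, h). (f, a, c, d, e, b, g, h))"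

text \<open>The planes of affine three-space over the field with two elements: label the point 8 by 0 and every other
point by itself, written in binary; then the blocks are the four-point sets whose labels add up to zero bitwise. Each
block is followed by its complement.\<close>

definition base_masks :: "mask list" where
  "base_masks =
    [(True, True, True, False, False, False, False, True), (False, False, False, True, True, True, True, False),
     (True, True, False, True, False, False, True, False), (False, False, True, False, True, True, False, True),
     (True, True, False, False, True, True, False, False), (False, False, True, True, False, False, True, True),
     (True, False, True, True, False, True, False, False), (False, True, False, False, True, False, True, True),
     (True, False, True, False, True, False, True, False), (False, True, False, True, False, True, False, True),
     (True, False, False, True, True, False, False, True), (False, True, True, False, False, True, True, False),
     (True, False, False, False, False, True, True, True), (False, True, True, True, True, False, False, False)]"

primrec structure_masks :: "nat \<Rightarrow> mask list" where
  "structure_masks 0 = base_masks"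
| "structure_masks (Suc i) = map zeta_mask (structure_masks i)"

text \<open>The images, under the powers of \<open>zeta\<close>, of one half of the pair of complementary blocks that the structures 0 and 1 share.\<close>

primrec split_mask :: "nat \<Rightarrow> mask" where
  "split_mask 0 = (True, True, False, False, True, True, False, False)"
| "split_mask (Suc i) = zeta_mask (split_mask i)"

lemma structure_masks_period: "structure_masks 15 = structure_masks 0"
  by code_simp

text \<open>A single three-cycle has to be checked: its conjugates under the powers of \<open>zeta\<close> generate the alternating
group.\<close>

lemma three_cycle_structure_masks:
  "\<forall>i\<in>set [0..<15]. \<exists>j\<in>set [0..<15]. \<forall>m\<in>set (structure_masks i). three_cycle_mask m \<in> set (structure_masks j)"
  by code_simp

definition incident_indices :: "mask \<Rightarrow> nat list" where
  "incident_indices m = filter (\<lambda>j. m \<in> set (structure_masks j)) [0..<15]"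

text \<open>The pairs of complementary blocks of structure 0 lie in exactly two further structures each. The resulting triples of
indices are the seven lines through the point 0 of the projective space.\<close>

lemma incidence_table:
  "map incident_indices base_masks =
    [[0, 11, 12], [0, 11, 12], [0, 6, 13], [0, 6, 13], [0, 1, 4], [0, 1, 4], [0, 2, 8],
     [0, 2, 8], [0, 7, 9], [0, 7, 9], [0, 3, 14], [0, 3, 14], [0, 5, 10], [0, 5, 10]]"
  by code_simp

lemma set_incident_indices: "set (incident_indices m) = {j. j < 15 \<and> m \<in> set (structure_masks j)}"
  unfolding incident_indices_def by auto

lemma common_base_masks:
  "filter (\<lambda>m. m \<in> set (structure_masks 1)) base_masks =
    [split_mask 0, (False, False, True, True, False, False, True, True)]"
  by code_simp

text \<open>Which of the fifteen splittings separate two given points determines this pair of points. Since the positions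
in a tuple are counted from zero, so are the points here.\<close>

lemma split_masks_separate_pairs:
  "distinct (map (\<lambda>(a, b). map (\<lambda>i. mask_list (split_mask i) ! a = mask_list (split_mask i) ! b) [0..<15])
     [(a, b). a \<leftarrow> [0..<8], b \<leftarrow> [a + 1..<8]])"
  by code_simp

lemma image_zeta: "zeta ` subset_of_mask m = subset_of_mask (zeta_mask m)"
proof -
  have [simp]: "zeta (Suc 0) = 2" "zeta 1 = 2" "zeta 2 = 3" "zeta 3 = 4" "zeta 4 = 5" "zeta 5 = 1" "zeta 6 = 7" "zeta 7 = 8" "zeta 8 = 6"
    by (simp_all add: zeta_def transpose_def)
  obtain a b c d e f g h where "m = (a, b, c, d, e, f, g, h)" by (cases m) auto
  then show ?thesis
    by (simp add: subset_of_mask_def zeta_mask_def image_Un if_distrib[of "image zeta"] Un_ac)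
qed

lemma image_three_cycle:
  "three_cycle 1 2 6 ` subset_of_mask m = subset_of_mask (three_cycle_mask m)"
proof -
  have [simp]: "three_cycle (Suc 0) 2 6 x = (if x = 1 then 2 else if x = 2 then 6 else if x = 6 then 1 else x)" for x :: nat
    by (simp add: three_cycle_apply)
  obtain a b c d e f g h where "m = (a, b, c, d, e, f, g, h)" by (cases m) auto
  then show ?thesis
    by (simp add: subset_of_mask_def three_cycle_mask_def image_Un if_distrib[of "image (three_cycle (Suc 0) 2 6)"] Un_ac)
qed

lemma mem_subset_of_mask:
  assumes "i < 8" shows "Suc i \<in> subset_of_mask m \<longleftrightarrow> mask_list m ! i"
proof -
  obtain a b c d e f g h where "m = (a, b, c, d, e, f, g, h)" by (cases m) auto
  moreover have "x \<in> (if P then {y} else {}) \<longleftrightarrow> P \<and> x = y" for P and x y :: nat by simp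
  moreover have "i = 0 \<or> i = 1 \<or> i = 2 \<or> i = 3 \<or> i = 4 \<or> i = 5 \<or> i = 6 \<or> i = 7" using assms by linarith
  ultimately show ?thesis by (elim disjE) (simp_all add: subset_of_mask_def mask_list_def)
qed

lemma inj_subset_of_mask: "inj subset_of_mask"
proof (rule injI)
  fix m m' assume eq: "subset_of_mask m = subset_of_mask m'"
  have "mask_list m = mask_list m'"
  proof (rule nth_equalityI)
    show "length (mask_list m) = length (mask_list m')" by (simp add: mask_list_def split: prod.splits)
    fix i assume "i < length (mask_list m)"
    then have "i < 8" by (simp add: mask_list_def split: prod.splits)
    then show "mask_list m ! i = mask_list m' ! i" using eq mem_subset_of_mask by metis
  qed
  then show "m = m'" by (simp add: mask_list_def split: prod.splits)
qed

section \<open>The alternating group permutes fifteen affine structures\<close>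

definition affine_structure :: "nat \<Rightarrow> nat set set" where
  "affine_structure i = subset_of_mask ` set (structure_masks i)"

lemma zeta_permutes: "zeta permutes {1..8}"
  unfolding zeta_def
  by (intro permutes_compose permutes_subset[OF cycle_permutes]) auto

lemma zeta_funpow_permutes: "zeta ^^ k permutes {1..8}"
  using zeta_permutes by (rule permutes_funpow)

lemma affine_structure_add: "affine_structure (i + k) = image (zeta ^^ k) ` affine_structure i"
proof (induction k)
  case (Suc k)
  have "affine_structure (i + Suc k) = image zeta ` affine_structure (i + k)"
    by (simp add: affine_structure_def image_image image_zeta)
  also have "\<dots> = image (zeta ^^ Suc k) ` affine_structure i"
    unfolding Suc by (simp add: image_image image_comp comp_def)
  finally show ?case .
qed simp

lemma affine_structure_period: "affine_structure (i + 15) = affine_structure i"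
proof -
  have "affine_structure (15 + i) = affine_structure (0 + i)"
    unfolding affine_structure_add by (simp add: affine_structure_def structure_masks_period)
  then show ?thesis by (simp add: add.commute)
qed

lemma affine_structure_mod: "affine_structure (i mod 15) = affine_structure i"
proof -
  have "affine_structure (j + 15 * k) = affine_structure j" for j k
  proof (induction k)
    case (Suc k)
    then show ?case using affine_structure_period[of "j + 15 * k"] by (simp add: algebra_simps)
  qed simp
  from this[of "i mod 15" "i div 15"] show ?thesis by simp
qed

lemma inj_image: "inj f \<Longrightarrow> inj (image f)"
  using inj_image_eq_iff by (intro injI) blast

lemma inj_image_of_permutes: "p permutes S \<Longrightarrow> inj (image p)"
  by (rule inj_image[OF permutes_inj])

lemma image_image_comp: "image (g \<circ> h) ` X = image g ` (image h ` X)"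
proof -
  have "image (g \<circ> h) = image g \<circ> image h" by (rule ext) (simp only: comp_apply image_comp)
  then show ?thesis by (simp only: image_comp)
qed

lemma length_base_masks: "length base_masks = 14"
  by (simp add: base_masks_def)

text \<open>Collinearity of three points of the projective space, for distinct indices: the corresponding structures have a block in common.\<close>

definition share_block :: "nat \<Rightarrow> nat \<Rightarrow> nat \<Rightarrow> bool" where
  "share_block i j k \<longleftrightarrow> affine_structure i \<inter> affine_structure j \<inter> affine_structure k \<noteq> {}"

lemma share_block_shift: "share_block (i + s) (j + s) (k + s) \<longleftrightarrow> share_block i j k"
proof -
  have inj: "inj (image (zeta ^^ s))" using inj_image_of_permutes[OF zeta_funpow_permutes] .
  have "affine_structure (i + s) \<inter> affine_structure (j + s) \<inter> affine_structure (k + s)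
      = image (zeta ^^ s) ` (affine_structure i \<inter> affine_structure j \<inter> affine_structure k)"
    unfolding affine_structure_add by (simp only: image_Int[OF inj])
  then show ?thesis unfolding share_block_def by simp
qed

lemma share_block_mod: "share_block (i mod 15) (j mod 15) (k mod 15) \<longleftrightarrow> share_block i j k"
  by (simp add: share_block_def affine_structure_mod)

lemma mem_affine_structure: "subset_of_mask m \<in> affine_structure i \<longleftrightarrow> m \<in> set (structure_masks i)"
  unfolding affine_structure_def using inj_subset_of_mask by (simp add: inj_image_mem_iff)

lemma incidence_nth:
  "{j. j < 15 \<and> base_masks ! 0 \<in> set (structure_masks j)} = {0, 11, 12}"
  "{j. j < 15 \<and> base_masks ! 2 \<in> set (structure_masks j)} = {0, 6, 13}"
  "{j. j < 15 \<and> base_masks ! 4 \<in> set (structure_masks j)} = {0, 1, 4}"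
proof -
  have nth: "incident_indices (base_masks ! k) = map incident_indices base_masks ! k" if "k < 14" for k
    using that length_base_masks by simp
  show "{j. j < 15 \<and> base_masks ! 0 \<in> set (structure_masks j)} = {0, 11, 12}"
    "{j. j < 15 \<and> base_masks ! 2 \<in> set (structure_masks j)} = {0, 6, 13}"
    "{j. j < 15 \<and> base_masks ! 4 \<in> set (structure_masks j)} = {0, 1, 4}"
    unfolding set_incident_indices[symmetric] by (simp_all add: nth incidence_table)
qed

lemma share_block_line: "share_block i (i + 1) (i + 4)"
proof -
  let ?m = "base_masks ! 4"
  have "{0, 1, 4} \<subseteq> {j. ?m \<in> set (structure_masks j)}" using incidence_nth(3) by blast
  then have "subset_of_mask ?m \<in> affine_structure 0 \<inter> affine_structure 1 \<inter> affine_structure 4"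
    using mem_affine_structure by auto
  then have "share_block 0 1 4" unfolding share_block_def by blast
  then show ?thesis using share_block_shift[of 0 i 1 4] by (simp add: add.commute)
qed

definition lines_through_zero :: "(nat \<times> nat) list" where
  "lines_through_zero = [(11, 12), (6, 13), (1, 4), (2, 8), (7, 9), (3, 14), (5, 10)]"

lemma incidence_cases:
  assumes "m \<in> set base_masks"
  obtains p q where "(p, q) \<in> set lines_through_zero" "{j. j < 15 \<and> m \<in> set (structure_masks j)} = {0, p, q}"
proof -
  have "incident_indices m \<in> set (map incident_indices base_masks)" using assms by simp
  then have "\<exists>pq\<in>set lines_through_zero. incident_indices m = [0, fst pq, snd pq]"
    unfolding incidence_table by (simp add: lines_through_zero_def)
  then show ?thesis using that set_incident_indices[of m] by auto
qed

lemma share_block_zero_cases: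
  assumes "share_block 0 j k" "j < 15" "k < 15" "distinct [0, j, k]"
  shows "(j, k) \<in> set lines_through_zero \<or> (k, j) \<in> set lines_through_zero"
proof -
  obtain B where B: "B \<in> affine_structure 0" "B \<in> affine_structure j" "B \<in> affine_structure k"
    using assms(1) unfolding share_block_def by blast
  then obtain m where m: "m \<in> set base_masks" "B = subset_of_mask m"
    unfolding affine_structure_def by auto
  obtain p q where pq: "(p, q) \<in> set lines_through_zero"
    "{j. j < 15 \<and> m \<in> set (structure_masks j)} = {0, p, q}"
    using incidence_cases[OF m(1)] .
  have "j \<in> {0, p, q}" "k \<in> {0, p, q}"
    unfolding pq(2)[symmetric] using B m assms(2,3) by (simp_all add: mem_affine_structure)
  then have "(j, k) = (p, q) \<or> (k, j) = (p, q)" using assms(4) by auto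
  then show ?thesis using pq(1) by blast
qed

text \<open>Two equal structures would differ by a shift \<open>d\<close>, and \<open>d\<close> would lie on all lines through 0; two of these meet in
0 only.\<close>

lemma inj_affine_structure: "inj_on affine_structure {..<15}"
proof -
  have ne: "affine_structure i \<noteq> affine_structure j" if ij: "i < j" "j < 15" for i j
  proof
    assume eq: "affine_structure i = affine_structure j"
    let ?d = "j - i"
    have "affine_structure (0 + i) = affine_structure (?d + i)" using eq ij by simp
    then have "affine_structure 0 = affine_structure ?d"
      unfolding affine_structure_add
      by (simp only: inj_image_eq_iff[OF inj_image_of_permutes[OF zeta_funpow_permutes]])
    then have all: "set base_masks \<subseteq> set (structure_masks ?d)"
      using mem_affine_structure by (metis structure_masks.simps(1) subsetI)
    let ?J = "\<lambda>m. {j. j < 15 \<and> m \<in> set (structure_masks j)}"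
    have mem: "?d \<in> ?J m - {0}" if "m \<in> set base_masks" for m
      using all that ij by auto
    have "?d \<in> {j, k}" if "?J (base_masks ! n) = {0, j, k}" "n < 14" for n j k
    proof -
      have "base_masks ! n \<in> set base_masks" using that length_base_masks by simp
      from mem[OF this] show ?thesis unfolding that(1) by blast
    qed
    from this[OF incidence_nth(1)] this[OF incidence_nth(2)] show False by auto
  qed
  then show ?thesis by (intro inj_onI) (metis lessThan_iff linorder_neqE_nat)
qed

definition family :: "nat set set set" where
  "family = affine_structure ` {..<15}"

lemma affine_structure_in_family: "affine_structure i \<in> family"
  unfolding family_def using affine_structure_mod[of i] by (intro image_eqI[of _ _ "i mod 15"]) auto

lemma three_cycle_family:
  assumes "X \<in> family" shows "image (three_cycle 1 2 6) ` X \<in> family"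
proof -
  let ?c = "three_cycle 1 2 6 :: nat \<Rightarrow> nat"
  obtain i where i: "i < 15" "X = affine_structure i" using assms by (auto simp: family_def)
  then obtain j where j: "\<forall>m\<in>set (structure_masks i). three_cycle_mask m \<in> set (structure_masks j)"
    using three_cycle_structure_masks by (metis atLeast_upt lessThan_iff)
  have sub: "image ?c ` affine_structure i \<subseteq> affine_structure j"
    using j unfolding affine_structure_def image_image image_three_cycle by blast
  have card: "card (affine_structure k) = card (affine_structure 0)" for k
    using affine_structure_add[of 0 k]
      card_image[OF inj_on_subset[OF inj_image_of_permutes[OF zeta_funpow_permutes] subset_UNIV]]
    by simp
  have "inj ?c" by (simp add: three_cycle_def inj_compose)
  then have "inj (image ?c)" by (rule inj_image)
  then have "card (image ?c ` affine_structure i) = card (affine_structure j)"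
    using card_image[OF inj_on_subset[OF _ subset_UNIV]] card by metis
  then have "image ?c ` affine_structure i = affine_structure j"
    using sub by (intro card_subset_eq) (simp_all add: affine_structure_def)
  then show ?thesis using i affine_structure_in_family by simp
qed

definition family_group :: "(nat \<Rightarrow> nat) set" where
  "family_group = {g. g permutes {1..8} \<and> (\<forall>X\<in>family. image g ` X \<in> family)}"

lemma family_groupI: "g permutes {1..8} \<Longrightarrow> (\<And>X. X \<in> family \<Longrightarrow> image g ` X \<in> family) \<Longrightarrow> g \<in> family_group"
  by (simp add: family_group_def)

lemma permutation_group_family: "permutation_group {1..8} family_group"
proof
  fix g h assume g: "g \<in> family_group" and h: "h \<in> family_group"
  show "g \<circ> h \<in> family_group"
  proof (rule family_groupI)
    show "g \<circ> h permutes {1..8}" using g h permutes_compose by (auto simp: family_group_def)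
    fix X assume "X \<in> family"
    then have "image g ` (image h ` X) \<in> family" using g h by (simp add: family_group_def)
    then show "image (g \<circ> h) ` X \<in> family" by (simp only: image_image_comp)
  qed
next
  fix h assume h: "h \<in> family_group"
  then have p: "h permutes {1..8}" and inj: "inj (\<lambda>X. image h ` X)"
    using inj_image[OF inj_image_of_permutes] by (auto simp: family_group_def)
  have "(\<lambda>X. image h ` X) ` family \<subseteq> family" using h by (auto simp: family_group_def)
  then have onto: "(\<lambda>X. image h ` X) ` family = family"
    using inj by (intro endo_inj_surj) (auto simp: family_def intro: inj_on_subset)
  have undo: "image (inv' h) ` (image h ` X) = X" for X :: "nat set set"
    using permutes_inj[OF p] by (simp add: image_image image_comp)
  show "inv' h \<in> family_group"
  proof (rule family_groupI)
    show "inv' h permutes {1..8}" using p by (rule permutes_inv)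
    fix X assume "X \<in> family"
    then have "X \<in> (\<lambda>X. image h ` X) ` family" by (simp only: onto)
    then obtain Y where "Y \<in> family" "X = image h ` Y" by (rule imageE)
    then show "image (inv' h) ` X \<in> family" using undo by simp
  qed
qed (auto simp: family_group_def permutes_id)

text \<open>The permutations that preserve the family form a group containing \<open>zeta\<close> and \<open>(1 2 6)\<close>. The conjugates of this
three-cycle under powers of \<open>zeta\<close> form a chain of overlapping triples that covers \<open>{1..8}\<close>.\<close>

lemma alt_group_preserves_family:
  assumes "g \<in> carrier (alt_group 8)" "X \<in> family"
  shows "image g ` X \<in> family"
proof -
  interpret permutation_group "{1..8}" family_group by (rule permutation_group_family)
  have z: "zeta \<in> family_group"
  proof (rule family_groupI[OF zeta_permutes])
    fix X assume "X \<in> family"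
    then obtain i where "X = affine_structure i" by (auto simp: family_def)
    then show "image zeta ` X \<in> family"
      using affine_structure_add[of i 1] affine_structure_in_family[of "i + 1"] by simp
  qed
  have c: "three_cycle 1 2 6 \<in> family_group"
  proof (rule family_groupI[OF _ three_cycle_family])
    show "three_cycle 1 2 6 permutes {1..8::nat}"
      unfolding three_cycle_def by (intro permutes_compose permutes_swap_id) auto
  qed
  have zv: "zeta 1 = 2" "zeta 2 = 3" "zeta 3 = 4" "zeta 4 = 5" "zeta 6 = 7" "zeta 7 = 8" "zeta 8 = 6"
    by (simp_all add: zeta_def transpose_def)
  have 1: "contains_alt {1, 2, 6}" by (rule contains_alt_triple[OF _ _ c]) auto
  have 2: "contains_alt {2, 3, 7}" using contains_alt_image[OF z 1] by (simp only: image_insert image_empty zv)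
  have 3: "contains_alt {3, 4, 8}" using contains_alt_image[OF z 2] by (simp only: image_insert image_empty zv)
  have 4: "contains_alt {4, 5, 6}" using contains_alt_image[OF z 3] by (simp only: image_insert image_empty zv)
  have "contains_alt {3, 1, 2, 6}" by (rule contains_alt_overlap[OF 1 2, of 2]) auto
  then have "contains_alt {7, 3, 1, 2, 6}" by (rule contains_alt_overlap[OF _ 2, of _ 2]) auto
  then have "contains_alt {4, 7, 3, 1, 2, 6}" by (rule contains_alt_overlap[OF _ 3, of _ 3]) auto
  then have "contains_alt {8, 4, 7, 3, 1, 2, 6}" by (rule contains_alt_overlap[OF _ 3, of _ 3]) auto
  then have "contains_alt {5, 8, 4, 7, 3, 1, 2, 6}" by (rule contains_alt_overlap[OF _ 4, of _ 4]) auto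
  moreover have "{5, 8, 4, 7, 3, 1, 2, 6} = {1..8::nat}" by auto
  ultimately have "carrier (alt_group 8) \<subseteq> family_group"
    using alt_group_subset_if_contains_alt[OF permutation_group_family] by simp
  then show ?thesis using assms by (auto simp: family_group_def)
qed

definition split_half :: "nat \<Rightarrow> nat set" where
  "split_half i = subset_of_mask (split_mask i)"

lemma split_half_image: "split_half i = (zeta ^^ i) ` split_half 0"
proof (induction i)
  case (Suc i)
  have "split_half (Suc i) = zeta ` split_half i" by (simp add: split_half_def image_zeta)
  then show ?case using Suc by (simp add: image_comp)
qed simp

lemma adjacent_structures:
  "affine_structure i \<inter> affine_structure (i + 1) = {split_half i, {1..8} - split_half i}"
proof -
  have "affine_structure 0 \<inter> affine_structure 1
      = subset_of_mask ` set (filter (\<lambda>m. m \<in> set (structure_masks 1)) base_masks)"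
    using inj_subset_of_mask by (auto simp: affine_structure_def dest: injD)
  also have "\<dots> = {split_half 0, subset_of_mask (False, False, True, True, False, False, True, True)}"
    unfolding common_base_masks split_half_def by simp
  also have "subset_of_mask (False, False, True, True, False, False, True, True) = {1..8} - split_half 0"
    by (auto simp: split_half_def subset_of_mask_def)
  finally have 0: "affine_structure 0 \<inter> affine_structure 1 = {split_half 0, {1..8} - split_half 0}" .
  have inj: "inj (zeta ^^ i)" using permutes_inj[OF zeta_funpow_permutes] .
  have "affine_structure i \<inter> affine_structure (i + 1)
      = image (zeta ^^ i) ` (affine_structure 0 \<inter> affine_structure 1)"
    using affine_structure_add[of 0 i] affine_structure_add[of 1 i]
      image_Int[OF inj_image_of_permutes[OF zeta_funpow_permutes]] by (simp add: add.commute)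
  also have "\<dots> = {split_half i, {1..8} - split_half i}"
    using image_set_diff[OF inj] permutes_image[OF zeta_funpow_permutes] split_half_image[of i]
    unfolding 0 by simp
  finally show ?thesis .
qed

lemma split_halves_separate_pairs:
  assumes "a \<in> {1..8}" "b \<in> {1..8}" "c \<in> {1..8}" "d \<in> {1..8}" "a \<noteq> b" "c \<noteq> d"
    and same: "\<And>i. ((a \<in> split_half i) = (b \<in> split_half i)) = ((c \<in> split_half i) = (d \<in> split_half i))"
  shows "{a, b} = {c, d}"
proof -
  let ?f = "\<lambda>(a, b). map (\<lambda>i. mask_list (split_mask i) ! a = mask_list (split_mask i) ! b) [0..<15]"
  let ?P = "[(a, b). a \<leftarrow> [0..<8], b \<leftarrow> [a + 1..<8]]"
  have inj: "inj_on ?f (set ?P)" using split_masks_separate_pairs by (simp only: distinct_map)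
  have P: "(a, b) \<in> set ?P" if "a < b" "b < 8" for a b using that by (auto intro!: bexI[of _ a])
  have ordered: "{a, b} = {c, d}"
    if ab: "a < b" "c < d" "a \<in> {1..8}" "b \<in> {1..8}" "c \<in> {1..8}" "d \<in> {1..8}"
      and s: "\<And>i. ((a \<in> split_half i) = (b \<in> split_half i)) = ((c \<in> split_half i) = (d \<in> split_half i))"
    for a b c d
  proof -
    have mem: "x \<in> split_half i \<longleftrightarrow> mask_list (split_mask i) ! (x - 1)" if "x \<in> {1..8}" for x i
      using that by (cases x) (auto simp: split_half_def mem_subset_of_mask)
    have "?f (a - 1, b - 1) = ?f (c - 1, d - 1)"
      using s ab(3-6) by (simp add: mem)
    moreover have "(a - 1, b - 1) \<in> set ?P" by (rule P) (use ab in \<open>auto\<close>)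
    moreover have "(c - 1, d - 1) \<in> set ?P" by (rule P) (use ab in \<open>auto\<close>)
    ultimately have "(a - 1, b - 1) = (c - 1, d - 1)" using inj by (meson inj_onD)
    then show ?thesis using ab by auto
  qed
  consider "a < b" "c < d" | "a < b" "d < c" | "b < a" "c < d" | "b < a" "d < c"
    using assms(5,6) by linarith
  then show ?thesis
  proof cases
    case 1 then show ?thesis using ordered assms by blast
  next
    case 2 then have "{a, b} = {d, c}" using assms by (intro ordered) auto
    then show ?thesis by blast
  next
    case 3 then have "{b, a} = {c, d}" using assms by (intro ordered) auto
    then show ?thesis by blast
  next
    case 4 then have "{b, a} = {d, c}" using assms by (intro ordered) auto
    then show ?thesis by blast
  qed
qed

text \<open>A permutation that fixes all structures fixes every intersection of two consecutive ones, hence all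
fifteen splittings, although it may interchange the halves. Whether two points are separated by a
splitting is unaffected by this, so every pair of points is fixed, and then every point.\<close>

lemma fixes_family_imp_id:
  assumes k: "k permutes {1..8}" and fixed: "\<And>X. X \<in> family \<Longrightarrow> image k ` X = X"
  shows "k = id"
proof -
  have same: "((k a \<in> split_half i) = (k b \<in> split_half i)) = ((a \<in> split_half i) = (b \<in> split_half i))"
    if ab: "a \<in> {1..8}" "b \<in> {1..8}" for a b i
  proof -
    have "image k ` (affine_structure i \<inter> affine_structure (i + 1)) = affine_structure i \<inter> affine_structure (i + 1)"
      using image_Int[OF inj_image_of_permutes[OF k]] fixed[OF affine_structure_in_family] by simp
    then have "image k ` {split_half i, {1..8} - split_half i} = {split_half i, {1..8} - split_half i}"
      unfolding adjacent_structures .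
    then have "k ` split_half i \<in> {split_half i, {1..8} - split_half i}"
      by (metis image_eqI insertI1)
    moreover have "k x \<in> k ` split_half i \<longleftrightarrow> x \<in> split_half i" for x
      using permutes_inj[OF k] by (simp add: inj_image_mem_iff)
    moreover have "k a \<in> {1..8}" "k b \<in> {1..8}" using ab permutes_in_image[OF k] by blast+
    ultimately show ?thesis by (metis Diff_iff insertE singletonD)
  qed
  have pairs: "{k a, k b} = {a, b}" if ab: "a \<in> {1..8}" "b \<in> {1..8}" "a \<noteq> b" for a b
    by (rule split_halves_separate_pairs)
      (use ab same permutes_in_image[OF k] permutes_inj[OF k] in \<open>auto dest: injD\<close>)
  have "k a = a" for a
  proof (cases "a \<in> {1..8}")
    case True
    obtain b where b: "b \<in> {1..8::nat}" "b \<noteq> a" using True by (intro that[of "if a = 1 then 2 else 1"]) auto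
    obtain c where c: "c \<in> {1..8::nat}" "c \<noteq> a" "c \<noteq> b"
    proof -
      have "\<not> {1..8} \<subseteq> {a, b}"
        using card_mono[of "{a, b}" "{1..8}"] by (auto simp: card_insert_if split: if_splits)
      then show ?thesis using that by blast
    qed
    have "k a \<in> {a, b}" "k a \<in> {a, c}" using pairs[of a b] pairs[of a c] True b c by blast+
    then show ?thesis using c by auto
  next
    case False then show ?thesis using permutes_not_in[OF k] by blast
  qed
  then show ?thesis by (simp add: fun_eq_iff)
qed

section \<open>The action on the simplex code\<close>

text \<open>Extended by the identity, as \<open>permutes\<close> requires.\<close>

definition alt8_action :: "(nat \<Rightarrow> nat) \<Rightarrow> nat \<Rightarrow> nat" where
  "alt8_action g i = (if i < 15 then inv_into {..<15} affine_structure (image g ` affine_structure i) else i)"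

lemma alt8_action:
  assumes "g \<in> carrier (alt_group 8)" "i < 15"
  shows "alt8_action g i < 15" "affine_structure (alt8_action g i) = image g ` affine_structure i"
proof -
  have "image g ` affine_structure i \<in> affine_structure ` {..<15}"
    using alt_group_preserves_family[OF assms(1) affine_structure_in_family] unfolding family_def .
  from inv_into_into[OF this] f_inv_into_f[OF this] assms(2)
  show "alt8_action g i < 15" "affine_structure (alt8_action g i) = image g ` affine_structure i"
    by (simp_all add: alt8_action_def)
qed

lemma affine_structure_eq_iff: "i < 15 \<Longrightarrow> j < 15 \<Longrightarrow> affine_structure i = affine_structure j \<longleftrightarrow> i = j"
  using inj_affine_structure by (auto dest: inj_onD)

lemma alt8_permutes: "g \<in> carrier (alt_group 8) \<Longrightarrow> g permutes {1..8}"
  by (simp add: alt_group_carrier)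

lemma alt8_action_permutes:
  assumes g: "g \<in> carrier (alt_group 8)"
  shows "alt8_action g permutes {..<15}"
proof (rule bij_imp_permutes)
  have "inj_on (alt8_action g) {..<15}"
  proof (rule inj_onI)
    fix i j assume ij: "i \<in> {..<15::nat}" "j \<in> {..<15}" "alt8_action g i = alt8_action g j"
    then have "image g ` affine_structure i = image g ` affine_structure j"
      using alt8_action(2)[OF g] by (metis lessThan_iff)
    then have "affine_structure i = affine_structure j"
      by (simp only: inj_image_eq_iff[OF inj_image_of_permutes[OF alt8_permutes[OF g]]])
    then show "i = j" using affine_structure_eq_iff ij by simp
  qed
  moreover have "alt8_action g ` {..<15} \<subseteq> {..<15}" using alt8_action(1)[OF g] by auto
  ultimately show "bij_betw (alt8_action g) {..<15} {..<15}"
    by (simp add: bij_betw_def endo_inj_surj)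
qed (simp add: alt8_action_def)

lemma alt8_action_comp:
  assumes g: "g \<in> carrier (alt_group 8)" and h: "h \<in> carrier (alt_group 8)"
  shows "alt8_action (g \<circ> h) = alt8_action g \<circ> alt8_action h"
proof
  have gh: "g \<circ> h \<in> carrier (alt_group 8)"
    using group.is_monoid[OF alt_group_is_group] monoid.m_closed g h by (metis alt_group_mult)
  fix i
  show "alt8_action (g \<circ> h) i = (alt8_action g \<circ> alt8_action h) i"
  proof (cases "i < 15")
    case True
    have "affine_structure (alt8_action (g \<circ> h) i) = image g ` (image h ` affine_structure i)"
      using alt8_action(2)[OF gh True] by (simp only: image_image_comp)
    also have "\<dots> = affine_structure (alt8_action g (alt8_action h i))"
      using alt8_action(2)[OF g alt8_action(1)[OF h True]] alt8_action(2)[OF h True] by simp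
    finally show ?thesis using alt8_action(1) True g h gh by (simp add: affine_structure_eq_iff)
  next
    case False then show ?thesis by (simp add: alt8_action_def)
  qed
qed

lemma alt8_action_inj: "inj_on alt8_action (carrier (alt_group 8))"
proof (rule inj_onI)
  fix g h assume g: "g \<in> carrier (alt_group 8)" and h: "h \<in> carrier (alt_group 8)"
    and eq: "alt8_action g = alt8_action h"
  have gp: "g permutes {1..8}" and hp: "h permutes {1..8}" using g h alt8_permutes by blast+
  have k: "inv' h \<circ> g permutes {1..8}" using permutes_compose[OF gp permutes_inv[OF hp]] .
  have "image (inv' h \<circ> g) ` X = X" if "X \<in> family" for X
  proof -
    obtain i where i: "i < 15" "X = affine_structure i" using \<open>X \<in> family\<close> by (auto simp: family_def)
    have "image g ` X = image h ` X" using alt8_action(2) g h eq i by metis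
    then have "image (inv' h \<circ> g) ` X = image (inv' h) ` (image h ` X)" by (simp only: image_image_comp)
    also have "\<dots> = image (inv' h \<circ> h) ` X" by (simp only: image_image_comp)
    finally show ?thesis by (simp add: permutes_inv_o(2)[OF hp])
  qed
  from fixes_family_imp_id[OF k this] have "inv' h \<circ> g = id" .
  then have "h \<circ> (inv' h \<circ> g) = h" by simp
  then show "g = h" by (simp add: o_assoc permutes_inv_o(1)[OF hp])
qed

lemma share_block_alt8_action:
  assumes g: "g \<in> carrier (alt_group 8)" and "i < 15" "j < 15" "k < 15"
  shows "share_block (alt8_action g i) (alt8_action g j) (alt8_action g k) \<longleftrightarrow> share_block i j k"
proof -
  have inj: "inj (image g)" using inj_image_of_permutes[OF alt8_permutes[OF g]] .
  show ?thesis
    unfolding share_block_def alt8_action(2)[OF g assms(2)] alt8_action(2)[OF g assms(3)] alt8_action(2)[OF g assms(4)]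
      image_Int[OF inj, symmetric] by simp
qed

text \<open>Given by the check equations of fifteen lines, the shifts of \<open>{0, 1, 4}\<close>. They express the linear recurrence with
characteristic polynomial \<open>x^4 + x + 1\<close>, whose solutions are the maximal-length sequences of period 15 and
zero.\<close>

definition simplex_code :: "bit vec set" where
  "simplex_code = {v \<in> carrier_vec 15. \<forall>i<15. v $ i + v $ ((i + 1) mod 15) + v $ ((i + 4) mod 15) = 0}"

definition periodic_entry :: "bit vec \<Rightarrow> nat \<Rightarrow> bit" where
  "periodic_entry v i = v $ (i mod 15)"

lemma periodic_entry_add: "periodic_entry v (i + 15) = periodic_entry v i"
  by (simp add: periodic_entry_def)

lemma simplex_code_recurrence:
  assumes "v \<in> simplex_code"
  shows "periodic_entry v i + periodic_entry v (i + 1) + periodic_entry v (i + 4) = 0"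
proof -
  have "i mod 15 < 15" by simp
  then have "v $ (i mod 15) + v $ ((i mod 15 + 1) mod 15) + v $ ((i mod 15 + 4) mod 15) = 0"
    using assms unfolding simplex_code_def by blast
  then show ?thesis by (simp only: periodic_entry_def mod_add_left_eq)
qed

text \<open>Sums of bits are to be rearranged as sums; the conversion to exclusive disjunction would prevent this.\<close>

declare add_bit_eq_xor [simp del]

text \<open>Adding up the equations of three lines yields a fourth one.\<close>

lemma bit_triangle:
  fixes x :: bit
  assumes "x + y + z = 0" "y + u + t = 0" "z + t + s = 0"
  shows "x + u + s = 0"
  using assms by (cases x; cases y; cases z; cases u; cases t; cases s) (simp_all add: add_bit_eq_xor)

lemma simplex_code_lines_through:
  assumes v: "v \<in> simplex_code" and pq: "(p, q) \<in> set lines_through_zero"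
  shows "periodic_entry v i + periodic_entry v (i + p) + periodic_entry v (i + q) = 0"
proof -
  let ?w = "periodic_entry v"
  note R = simplex_code_recurrence[OF v]
  have idx: "i + 1 + 1 = i + 2" "i + 1 + 4 = i + 5" "i + 4 + 1 = i + 5" "i + 4 + 4 = i + 8"
    "i + 2 + 2 = i + 4" "i + 2 + 8 = i + 10" for i :: nat by simp_all
  have R2: "?w i + ?w (i + 2) + ?w (i + 8) = 0" for i
    using bit_triangle[OF R[of i] R[of "i + 1", unfolded idx] R[of "i + 4", unfolded idx]] .
  have R5: "?w i + ?w (i + 5) + ?w (i + 10) = 0"
  proof (rule bit_triangle[OF R[of i]])
    show "?w (i + 1) + ?w (i + 5) + ?w (i + 2) = 0"
      using R[of "i + 1", unfolded idx] by (simp only: ac_simps)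
    show "?w (i + 4) + ?w (i + 2) + ?w (i + 10) = 0"
      using R2[of "i + 2", unfolded idx] by (simp only: ac_simps)
  qed
  have shift: "?w (i + s + t) = ?w (i + r)" if "s + t = r + 15" for s t r
    using periodic_entry_add[of v "i + r"] that by (metis add.assoc)
  have "?w (i + 11) + ?w i + ?w (i + 12) = 0" "?w (i + 14) + ?w i + ?w (i + 3) = 0"
    using R[of "i + 11"] R[of "i + 14"] shift[of 11 4 0] shift[of 14 1 0] shift[of 14 4 3]
    by (simp_all add: ac_simps)
  moreover have "?w (i + 7) + ?w (i + 9) + ?w i = 0" "?w (i + 13) + ?w i + ?w (i + 6) = 0"
    using R2[of "i + 7"] R2[of "i + 13"] shift[of 7 8 0] shift[of 13 2 0] shift[of 13 8 6]
    by (simp_all add: ac_simps)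
  ultimately show ?thesis
    using pq R[of i] R2[of i] R5 by (auto simp: lines_through_zero_def ac_simps)
qed

text \<open>By cyclic symmetry one of the three indices may be assumed to be zero, and the triple is one of the seven lines
through 0.\<close>

lemma simplex_code_share_block:
  assumes v: "v \<in> simplex_code" and ijk: "i < 15" "j < 15" "k < 15" "distinct [i, j, k]" "share_block i j k"
  shows "v $ i + v $ j + v $ k = 0"
proof -
  define p q where "p = (j + (15 - i)) mod 15" and "q = (k + (15 - i)) mod 15"
  have "share_block (i + (15 - i)) (j + (15 - i)) (k + (15 - i))" using ijk(5) by (simp only: share_block_shift)
  then have "share_block ((i + (15 - i)) mod 15) p q" unfolding p_def q_def by (simp only: share_block_mod)
  then have m: "share_block 0 p q" using ijk(1) by simp
  have unshift: "(i + (l + (15 - i)) mod 15) mod 15 = l" if "l < 15" for l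
  proof -
    have "(i + (l + (15 - i)) mod 15) mod 15 = (i + (l + (15 - i))) mod 15" by (simp add: mod_simps)
    also have "i + (l + (15 - i)) = l + 15" using ijk(1) by simp
    finally show ?thesis using that by simp
  qed
  have pq: "(i + p) mod 15 = j" "(i + q) mod 15 = k" "p < 15" "q < 15"
    using unshift ijk unfolding p_def q_def by simp_all
  have "p \<noteq> 0" "q \<noteq> 0"
  proof -
    have "(i + 0) mod 15 \<noteq> j" "(i + 0) mod 15 \<noteq> k" using ijk by auto
    then show "p \<noteq> 0" "q \<noteq> 0" using pq by metis+
  qed
  moreover have "p \<noteq> q" using pq ijk by auto
  ultimately have d: "distinct [0, p, q]" by auto
  have w: "periodic_entry v i = v $ i" "periodic_entry v (i + p) = v $ j" "periodic_entry v (i + q) = v $ k"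
    using pq ijk(1) by (simp_all add: periodic_entry_def)
  from share_block_zero_cases[OF m pq(3,4) d] show ?thesis
  proof
    assume "(p, q) \<in> set lines_through_zero"
    from simplex_code_lines_through[OF v this, of i] show ?thesis by (simp only: w)
  next
    assume "(q, p) \<in> set lines_through_zero"
    from simplex_code_lines_through[OF v this, of i] show ?thesis by (simp only: w ac_simps)
  qed
qed

text \<open>Every check equation is attached to a line, and the action of the alternating group permutes the lines because it
preserves common blocks.\<close>

lemma alt8_action_code_aut:
  assumes g: "g \<in> carrier (alt_group 8)"
  shows "alt8_action g \<in> carrier (code_aut 15 simplex_code)"
  unfolding code_aut_carrier
proof (intro conjI ballI)
  let ?p = "alt8_action g"
  show p: "?p permutes {..<15}" by (rule alt8_action_permutes[OF g])
  fix v assume v: "v \<in> simplex_code"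
  then have dim: "v \<in> carrier_vec 15" by (simp add: simplex_code_def)
  have inv_less: "inv' ?p i < 15" if "i < 15" for i
    using permutes_in_image[OF permutes_inv[OF p], of i] that by simp
  have "v $ inv' ?p i + v $ inv' ?p ((i + 1) mod 15) + v $ inv' ?p ((i + 4) mod 15) = 0" if i: "i < 15" for i
  proof (rule simplex_code_share_block[OF v])
    show "inv' ?p i < 15" "inv' ?p ((i + 1) mod 15) < 15" "inv' ?p ((i + 4) mod 15) < 15"
      using inv_less i by simp_all
    have "distinct [i, (i + 1) mod 15, (i + 4) mod 15]" using i by (simp add: mod_if) presburger
    then show "distinct [inv' ?p i, inv' ?p ((i + 1) mod 15), inv' ?p ((i + 4) mod 15)]"
      using permutes_inj[OF permutes_inv[OF p]] by (auto dest: injD)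
    have "share_block (i mod 15) ((i + 1) mod 15) ((i + 4) mod 15)" unfolding share_block_mod by (rule share_block_line)
    moreover have "share_block (inv' ?p i) (inv' ?p ((i + 1) mod 15)) (inv' ?p ((i + 4) mod 15))
        \<longleftrightarrow> share_block (?p (inv' ?p i)) (?p (inv' ?p ((i + 1) mod 15))) (?p (inv' ?p ((i + 4) mod 15)))"
      using share_block_alt8_action[OF g] inv_less i by simp
    ultimately show "share_block (inv' ?p i) (inv' ?p ((i + 1) mod 15)) (inv' ?p ((i + 4) mod 15))"
      using i by (simp add: permutes_inverses(1)[OF p])
  qed
  then show "permute_coords ?p v \<in> simplex_code"
    using dim by (auto simp: simplex_code_def permute_coords_def)
qed

section \<open>The automorphism group of the simplex code\<close>

lemma bit_check_add:
  fixes a :: bit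
  assumes "a + b + c = 0" "a' + b' + c' = 0"
  shows "a + a' + (b + b') + (c + c') = 0"
proof -
  have "a + a' + (b + b') + (c + c') = (a + b + c) + (a' + b' + c')" by (simp only: ac_simps)
  then show ?thesis using assms by simp
qed

lemma simplex_code_linear: "binary_linear_code 15 simplex_code"
  unfolding binary_linear_code_def subspace_def submodule_def
proof (intro conjI allI impI)
  show "vectorspace class_ring (module_vec TYPE(bit) 15)"
    by (rule vec_vs)
  show "Module.module class_ring (module_vec TYPE(bit) 15)"
    by (rule vec_module)
  fix v w assume "v \<in> simplex_code" "w \<in> simplex_code"
  then show "v \<oplus>\<^bsub>module_vec TYPE(bit) 15\<^esub> w \<in> simplex_code"
    by (auto simp: simplex_code_def module_vec_simps intro!: bit_check_add)
next
  fix c v assume "v \<in> simplex_code"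
  then show "c \<odot>\<^bsub>module_vec TYPE(bit) 15\<^esub> v \<in> simplex_code"
    by (cases c) (auto simp: simplex_code_def module_vec_simps)
qed (auto simp: simplex_code_def module_vec_simps)

definition shift15 :: "nat \<Rightarrow> nat" where
  "shift15 i = (if i < 15 then (i + 1) mod 15 else i)"

lemma cycle_of_list_upt: "cycle_of_list [0..<15] = shift15"
proof
  fix x :: nat
  show "cycle_of_list [0..<15] x = shift15 x"
  proof (cases "x < 15")
    case True
    have "map (cycle_of_list [0..<15] ^^ 1) [0..<15] ! x = rotate 1 [0..<15] ! x"
      by (simp only: cyclic_rotation distinct_upt)
    then show ?thesis using True by (simp add: nth_rotate1 shift15_def del: upt_rec_numeral)
  next
    case False
    then show ?thesis using id_outside_supp[of x "[0..<15]"] by (simp add: shift15_def del: upt_rec_numeral)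
  qed
qed

lemma simplex_code_cyclic: "binary_cyclic_code 15 simplex_code"
  unfolding binary_cyclic_code_def
proof (intro conjI exI[of _ "[0..<15]"])
  show "binary_linear_code 15 simplex_code" by (rule simplex_code_linear)
  let ?s = "cycle_of_list [0..<15]"
  show "set [0..<15] = {..<15::nat}" by auto
  have p: "?s permutes {..<15}"
    using cycle_permutes[of "[0..<15]"] by (simp only: set_upt atLeast0LessThan)
  have inv: "inv' ?s ((i + 1) mod 15) = i" if "i < 15" for i
    using permutes_inverses(2)[OF p, of i] that by (simp only: cycle_of_list_upt shift15_def if_True)
  have entry: "permute_coords ?s v $ i = periodic_entry v (i + 14)" if "i < 15" "v \<in> carrier_vec 15" for i v
  proof -
    have "((i + 14) mod 15 + 1) mod 15 = i" using that(1) by presburger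
    then have "inv' ?s i = (i + 14) mod 15" using inv[of "(i + 14) mod 15"] by simp
    then show ?thesis using that by (simp add: permute_coords_def periodic_entry_def)
  qed
  have "permute_coords ?s v \<in> simplex_code" if v: "v \<in> simplex_code" for v
  proof -
    have dim: "v \<in> carrier_vec 15" using v by (simp add: simplex_code_def)
    have "permute_coords ?s v $ i + permute_coords ?s v $ ((i + 1) mod 15) + permute_coords ?s v $ ((i + 4) mod 15) = 0"
      if i: "i < 15" for i
    proof -
      have e: "permute_coords ?s v $ (l mod 15) = periodic_entry v (l + 14)" for l
        using entry[OF _ dim, of "l mod 15"] by (simp add: periodic_entry_def mod_simps)
      show ?thesis
        using simplex_code_recurrence[OF v, of "i + 14"] e[of i] e[of "i + 1"] e[of "i + 4"] i
        by (simp add: ac_simps)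
    qed
    then show ?thesis using dim by (simp add: simplex_code_def permute_coords_def)
  qed
  then show "?s \<in> carrier (code_aut 15 simplex_code)" using p by (simp only: code_aut_carrier ball_simps) blast
qed simp

text \<open>One period of the recurrence. Its cyclic shifts are codewords, and as it has no smaller period they
separate any two coordinates.\<close>

definition m_sequence :: "bit vec" where
  "m_sequence = vec_of_list [1, 0, 0, 0, 1, 0, 0, 1, 1, 0, 1, 0, 1, 1, 1]"

lemma m_sequence_aperiodic: "\<forall>d\<in>set [1..<15]. \<exists>s\<in>set [0..<15]. m_sequence $ s \<noteq> m_sequence $ ((s + d) mod 15)"
  by code_simp

lemma m_sequence_checks:
  "\<forall>i\<in>set [0..<15]. m_sequence $ i + m_sequence $ ((i + 1) mod 15) + m_sequence $ ((i + 4) mod 15) = 0"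
  by code_simp

lemma m_sequence_code: "m_sequence \<in> simplex_code"
  unfolding simplex_code_def
proof (intro CollectI conjI allI impI)
  have "dim_vec m_sequence = length [1 :: bit, 0, 0, 0, 1, 0, 0, 1, 1, 0, 1, 0, 1, 1, 1]"
    unfolding m_sequence_def by (rule dim_vec_of_list)
  also have "\<dots> = 15" by simp
  finally show "m_sequence \<in> carrier_vec 15" by (rule carrier_vecI)
  fix i :: nat assume "i < 15"
  then have "i \<in> set [0..<15]" by (simp only: set_upt atLeastLessThan_iff le0 simp_thms)
  then show "m_sequence $ i + m_sequence $ ((i + 1) mod 15) + m_sequence $ ((i + 4) mod 15) = 0"
    by (rule bspec[OF m_sequence_checks])
qed

lemma simplex_code_shift:
  assumes v: "v \<in> simplex_code"
  shows "vec 15 (\<lambda>i. periodic_entry v (i + s)) \<in> simplex_code"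
proof -
  have per: "periodic_entry v (i mod 15 + s) = periodic_entry v (i + s)" for i
    by (simp add: periodic_entry_def mod_simps)
  have "periodic_entry v (i + s) + periodic_entry v (i + 1 + s) + periodic_entry v (i + 4 + s) = 0" for i
    using simplex_code_recurrence[OF v, of "i + s"] by (simp add: ac_simps)
  then show ?thesis by (simp only: simplex_code_def mem_Collect_eq vec_carrier) (simp add: per)
qed

lemma simplex_code_separates:
  assumes "i < 15" "j < 15" and same: "\<And>v. v \<in> simplex_code \<Longrightarrow> v $ i = v $ j"
  shows "i = j"
proof -
  have ord: False if ij: "i < j" "j < 15" and same: "\<And>v. v \<in> simplex_code \<Longrightarrow> v $ i = v $ j" for i j :: nat
  proof -
    have "j - i \<in> set [1..<15]" using ij by auto
    then obtain s where s: "s < 15" "m_sequence $ s \<noteq> m_sequence $ ((s + (j - i)) mod 15)"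
      using m_sequence_aperiodic by (metis atLeast_upt lessThan_iff)
    \<comment> \<open>The shift that takes position \<open>i\<close> to position \<open>s\<close>; adding 15 keeps the subtraction exact.\<close>
    let ?v = "vec 15 (\<lambda>l. periodic_entry m_sequence (l + (s + 15 - i)))"
    have "?v $ i = periodic_entry m_sequence (i + (s + 15 - i))" by (rule index_vec) (use ij in \<open>simp\<close>)
    also have "i + (s + 15 - i) = s + 15" using ij by simp
    also have "periodic_entry m_sequence (s + 15) = m_sequence $ s"
      unfolding periodic_entry_add using s(1) by (simp add: periodic_entry_def)
    finally have vi: "?v $ i = m_sequence $ s" .
    have "?v $ j = periodic_entry m_sequence (j + (s + 15 - i))" by (rule index_vec) (rule ij(2))
    also have "j + (s + 15 - i) = s + (j - i) + 15" using ij by simp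
    also have "periodic_entry m_sequence (s + (j - i) + 15) = m_sequence $ ((s + (j - i)) mod 15)"
      unfolding periodic_entry_add by (simp only: periodic_entry_def)
    finally show False using vi s(2) same[OF simplex_code_shift[OF m_sequence_code]] by metis
  qed
  show ?thesis using ord[of i j] ord[of j i] assms by (metis linorder_neqE_nat)
qed

text \<open>Counting the choices for one more coordinate of a tuple, given the previous ones.\<close>

lemma card_image_pair_le:
  assumes fin: "finite X" and fibre: "\<And>x. x \<in> X \<Longrightarrow> card (g ` {y \<in> X. f y = f x}) \<le> k"
  shows "card ((\<lambda>x. (f x, g x)) ` X) \<le> k * card (f ` X)"
proof -
  have "(\<lambda>x. (f x, g x)) ` X \<subseteq> Sigma (f ` X) (\<lambda>a. g ` {y \<in> X. f y = a})" by auto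
  then have "card ((\<lambda>x. (f x, g x)) ` X) \<le> card (Sigma (f ` X) (\<lambda>a. g ` {y \<in> X. f y = a}))"
    using fin by (intro card_mono finite_SigmaI) auto
  also have "\<dots> = (\<Sum>a\<in>f ` X. card (g ` {y \<in> X. f y = a}))"
    using fin by (intro card_SigmaI) auto
  also have "\<dots> \<le> (\<Sum>a\<in>f ` X. k)" using fibre by (intro sum_mono) auto
  finally show ?thesis by (simp add: mult.commute)
qed

text \<open>An automorphism is compatible with the third point on a line: the bit of any codeword at the image of \<open>k\<close> is the sum of
the bits at the images of \<open>i\<close> and \<open>j\<close>, and codewords separate coordinates.\<close>

lemma simplex_code_aut_line:
  assumes s: "\<sigma> \<in> carrier (code_aut 15 simplex_code)" and t: "\<tau> \<in> carrier (code_aut 15 simplex_code)"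
    and line: "\<And>v. v \<in> simplex_code \<Longrightarrow> v $ i + v $ j + v $ k = 0" and ijk: "i < 15" "j < 15" "k < 15"
    and agree: "\<sigma> i = \<tau> i" "\<sigma> j = \<tau> j"
  shows "\<sigma> k = \<tau> k"
proof (rule simplex_code_separates)
  interpret G: group "code_aut 15 simplex_code" by (rule group_code_aut[OF simplex_code_linear])
  have pull: "v $ \<rho> i + v $ \<rho> j + v $ \<rho> k = 0"
    if r: "\<rho> \<in> carrier (code_aut 15 simplex_code)" and v: "v \<in> simplex_code" for \<rho> v
  proof -
    have p: "\<rho> permutes {..<15}" using r by (simp add: code_aut_carrier)
    have dim: "v \<in> carrier_vec 15" using v by (simp add: simplex_code_def)
    let ?r = "inv\<^bsub>code_aut 15 simplex_code\<^esub> \<rho>"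
    have "?r \<circ> \<rho> = id" using G.l_inv[OF r] by (simp add: code_aut_def coord_sym_def)
    then have "?r = inv' \<rho>" using permutes_inv_o(1)[OF p] by (metis comp_assoc comp_id id_comp)
    then have inv: "inv' \<rho> \<in> carrier (code_aut 15 simplex_code)" using G.inv_closed[OF r] by simp
    then have "permute_coords (inv' \<rho>) v \<in> simplex_code" using v by (simp add: code_aut_carrier)
    from line[OF this] show ?thesis
      using ijk dim by (simp add: permute_coords_def permutes_inv_inv[OF p])
  qed
  show "\<sigma> k < 15" "\<tau> k < 15"
    using s t ijk(3) permutes_in_image[of _ "{..<15}" k] by (auto simp: code_aut_carrier)
  fix v assume v: "v \<in> simplex_code"
  have "v $ \<sigma> i + v $ \<sigma> j + v $ \<sigma> k = v $ \<sigma> i + v $ \<sigma> j + v $ \<tau> k"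
    using pull[OF s v] pull[OF t v] agree by simp
  then show "v $ \<sigma> k = v $ \<tau> k" by (simp only: add_left_cancel)
qed

text \<open>An automorphism is determined by the images of the points 0, 1, 2 and 3, a basis of the underlying space. The image
of each of these must avoid the span of the images of the earlier ones, whose sizes are 0, 1, 3 and 7; this leaves
\<open>15 * 14 * 12 * 8\<close> possibilities.\<close>

lemma simplex_code_aut_card: "card (carrier (code_aut 15 simplex_code)) \<le> 20160"
proof -
  let ?G = "carrier (code_aut 15 simplex_code)"
  have fin: "finite ?G"
    by (rule finite_subset[of _ "{p. p permutes {..<15}}"]) (auto simp: code_aut_carrier finite_permutations)
  have line: "v $ i + v $ (i + 1) + v $ (i + 4) = 0" "v $ i + v $ (i + 2) + v $ (i + 8) = 0"
    if v: "v \<in> simplex_code" and i: "i < 7" for v i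
    using simplex_code_lines_through[OF v, of 1 4 i] simplex_code_lines_through[OF v, of 2 8 i] i
    by (simp_all add: lines_through_zero_def periodic_entry_def)
  have agree: "\<sigma> (i + 4) = \<tau> (i + 4)"
    if "\<sigma> \<in> ?G" "\<tau> \<in> ?G" "\<sigma> i = \<tau> i" "\<sigma> (i + 1) = \<tau> (i + 1)" "i < 11" for \<sigma> \<tau> i
    using simplex_code_aut_line[OF that(1,2), of i "i + 1" "i + 4"] that
      simplex_code_lines_through[of _ 1 4 i]
    by (simp add: lines_through_zero_def periodic_entry_def)
  have agree8: "\<sigma> (i + 8) = \<tau> (i + 8)"
    if "\<sigma> \<in> ?G" "\<tau> \<in> ?G" "\<sigma> i = \<tau> i" "\<sigma> (i + 2) = \<tau> (i + 2)" "i < 7" for \<sigma> \<tau> i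
    using simplex_code_aut_line[OF that(1,2), of i "i + 2" "i + 8"] that line(2)[of _ i] by simp
  have fibre: "card ((\<lambda>\<tau>. \<tau> t) ` {\<tau> \<in> ?G. f \<tau> = f \<sigma>}) \<le> 15 - card F"
    if s: "\<sigma> \<in> ?G" and F: "F \<subseteq> {..<15}" "t < 15" "t \<notin> F"
      and det: "\<And>\<tau> x. \<tau> \<in> ?G \<Longrightarrow> f \<tau> = f \<sigma> \<Longrightarrow> x \<in> F \<Longrightarrow> \<tau> x = \<sigma> x" for \<sigma> f F t
  proof -
    have p: "\<tau> permutes {..<15}" if "\<tau> \<in> ?G" for \<tau> using that by (simp add: code_aut_carrier)
    have "(\<lambda>\<tau>. \<tau> t) ` {\<tau> \<in> ?G. f \<tau> = f \<sigma>} \<subseteq> {..<15} - \<sigma> ` F"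
    proof
      fix y assume "y \<in> (\<lambda>\<tau>. \<tau> t) ` {\<tau> \<in> ?G. f \<tau> = f \<sigma>}"
      then obtain \<tau> where tau: "\<tau> \<in> ?G" "f \<tau> = f \<sigma>" "y = \<tau> t" by blast
      have "\<tau> t \<noteq> \<tau> x" if "x \<in> F" for x
        using permutes_inj[OF p[OF tau(1)]] F(3) that by (auto dest: injD)
      then have "y \<notin> \<sigma> ` F" using det[OF tau(1,2)] tau(3) by auto
      then show "y \<in> {..<15} - \<sigma> ` F" using permutes_in_image[OF p[OF tau(1)], of t] F(2) tau(3) by simp
    qed
    then have "card ((\<lambda>\<tau>. \<tau> t) ` {\<tau> \<in> ?G. f \<tau> = f \<sigma>}) \<le> card ({..<15} - \<sigma> ` F)"
      by (intro card_mono) auto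
    also have "\<dots> = 15 - card (\<sigma> ` F)"
      using F(1) permutes_image[OF p[OF s]] finite_subset[OF F(1)] by (subst card_Diff_subset) auto
    also have "card (\<sigma> ` F) = card F" by (rule card_image[OF permutes_inj_on[OF p[OF s]]])
    finally show ?thesis .
  qed
  have c0: "card ((\<lambda>\<tau>. \<tau> 0) ` ?G) \<le> 15"
  proof -
    have "(\<lambda>\<tau>. \<tau> 0) ` ?G \<subseteq> {..<15}"
      using permutes_in_image[of _ "{..<15::nat}" 0] by (auto simp: code_aut_carrier)
    from card_mono[OF _ this] show ?thesis by simp
  qed
  let ?f1 = "\<lambda>\<tau>. (\<tau> 0, \<tau> 1)" and ?f2 = "\<lambda>\<tau>. ((\<tau> 0, \<tau> 1), \<tau> 2)" and ?f3 = "\<lambda>\<tau>. (((\<tau> 0, \<tau> 1), \<tau> 2), \<tau> (3::nat) :: nat)"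
  have "card (?f1 ` ?G) \<le> 14 * card ((\<lambda>\<tau>. \<tau> 0) ` ?G)"
  proof (rule card_image_pair_le[OF fin])
    fix \<sigma> assume "\<sigma> \<in> ?G"
    from fibre[OF this, of "{0}" 1 "\<lambda>\<tau>. \<tau> 0"]
    show "card ((\<lambda>\<tau>. \<tau> 1) ` {\<tau> \<in> ?G. \<tau> 0 = \<sigma> 0}) \<le> 14" by simp
  qed
  moreover have "card (?f2 ` ?G) \<le> 12 * card (?f1 ` ?G)"
  proof (rule card_image_pair_le[OF fin])
    fix \<sigma> assume s: "\<sigma> \<in> ?G"
    have "card ((\<lambda>\<tau>. \<tau> 2) ` {\<tau> \<in> ?G. ?f1 \<tau> = ?f1 \<sigma>}) \<le> 15 - card {0, 1, 4 :: nat}"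
    proof (rule fibre[OF s, of "{0, 1, 4}" 2 ?f1])
      show "\<tau> x = \<sigma> x" if t: "\<tau> \<in> ?G" "?f1 \<tau> = ?f1 \<sigma>" "x \<in> {0, 1, 4}" for \<tau> and x :: nat
        using that agree[OF t(1) s, of 0] by auto
    qed simp_all
    then show "card ((\<lambda>\<tau>. \<tau> 2) ` {\<tau> \<in> ?G. ?f1 \<tau> = ?f1 \<sigma>}) \<le> 12" by simp
  qed
  moreover have "card (?f3 ` ?G) \<le> 8 * card (?f2 ` ?G)"
  proof (rule card_image_pair_le[OF fin])
    fix \<sigma> assume s: "\<sigma> \<in> ?G"
    have "card ((\<lambda>\<tau>. \<tau> 3) ` {\<tau> \<in> ?G. ?f2 \<tau> = ?f2 \<sigma>}) \<le> 15 - card {0, 1, 2, 4, 5, 8, 10 :: nat}"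
    proof (rule fibre[OF s, of "{0, 1, 2, 4, 5, 8, 10}" 3 ?f2])
      fix \<tau> and x :: nat assume t: "\<tau> \<in> ?G" "?f2 \<tau> = ?f2 \<sigma>" "x \<in> {0, 1, 2, 4, 5, 8, 10}"
      have "\<tau> 0 = \<sigma> 0" "\<tau> 1 = \<sigma> 1" "\<tau> 2 = \<sigma> 2" using t(2) by auto
      moreover from this have "\<tau> 4 = \<sigma> 4" "\<tau> 5 = \<sigma> 5" "\<tau> 8 = \<sigma> 8"
        using agree[OF t(1) s, of 0] agree[OF t(1) s, of 1] agree8[OF t(1) s, of 0]
        by (simp_all add: numeral_2_eq_2)
      moreover from calculation have "\<tau> 10 = \<sigma> 10" using agree8[OF t(1) s, of 2] by simp
      ultimately show "\<tau> x = \<sigma> x" using t(3) by auto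
    qed simp_all
    then show "card ((\<lambda>\<tau>. \<tau> 3) ` {\<tau> \<in> ?G. ?f2 \<tau> = ?f2 \<sigma>}) \<le> 8" by simp
  qed
  moreover have "card (?f3 ` ?G) = card ?G"
  proof (rule card_image, rule inj_onI)
    fix \<sigma> \<tau> assume st: "\<sigma> \<in> ?G" "\<tau> \<in> ?G" "?f3 \<sigma> = ?f3 \<tau>"
    have small: "\<sigma> x = \<tau> x" if "x < 15" for x
      using that
    proof (induction x rule: less_induct)
      case (less x)
      show ?case
      proof (cases "x < 4")
        case True
        then have "x = 0 \<or> x = 1 \<or> x = 2 \<or> x = 3" by auto
        then show ?thesis using st(3) by auto
      next
        case False
        then obtain i where "x = i + 4" by (metis add.commute le_Suc_ex not_less)
        then show ?thesis using agree[OF st(1,2), of i] less by simp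
      qed
    qed
    have "\<sigma> x = \<tau> x" for x
    proof (cases "x < 15")
      case False
      then show ?thesis
        using st(1,2) permutes_not_in[of \<sigma> "{..<15}" x] permutes_not_in[of \<tau> "{..<15}" x]
        by (simp add: code_aut_carrier)
    qed (rule small)
    then show "\<sigma> = \<tau>" by (simp add: fun_eq_iff)
  qed
  ultimately show ?thesis using c0 by linarith
qed

theorem simplex_code_aut_alternating: "code_aut 15 simplex_code \<cong> alt_group 8"
proof -
  let ?A = "carrier (alt_group 8)" and ?G = "carrier (code_aut 15 simplex_code)"
  have sub: "alt8_action ` ?A \<subseteq> ?G" using alt8_action_code_aut by blast
  have fin: "finite ?G"
    by (rule finite_subset[of _ "{p. p permutes {..<15}}"]) (auto simp: code_aut_carrier finite_permutations)
  have "card ?A = 20160" using alt_group_card_carrier[of 8] by (simp add: fact_numeral)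
  then have "card ?G \<le> card (alt8_action ` ?A)"
    using simplex_code_aut_card card_image[OF alt8_action_inj] by simp
  then have "alt8_action ` ?A = ?G" using sub fin by (intro card_seteq)
  then have "bij_betw alt8_action ?A ?G" using alt8_action_inj by (simp add: bij_betw_def)
  moreover have "alt8_action \<in> hom (alt_group 8) (code_aut 15 simplex_code)"
    using alt8_action_code_aut alt8_action_comp by (intro homI) (simp_all add: alt_group_mult)
  ultimately have "alt_group 8 \<cong> code_aut 15 simplex_code" unfolding is_iso_def iso_def by blast
  then show ?thesis by (rule group.iso_sym[OF alt_group_is_group])
qed

theorem theorem2:
  shows "(\<forall>N C n. binary_cyclic_code N C \<and> (n \<in> {3, 4, 5, 6, 7} \<or> n \<ge> 9)
            \<longrightarrow> \<not> code_aut N C \<cong> alt_group n)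
       \<and> (\<exists>C. binary_cyclic_code 15 C \<and> code_aut 15 C \<cong> alt_group 8)"
proof (intro conjI allI impI)
  fix N C and n :: nat
  assume "binary_cyclic_code N C \<and> (n \<in> {3, 4, 5, 6, 7} \<or> n \<ge> 9)"
  then show "\<not> code_aut N C \<cong> alt_group n" by (intro code_aut_not_alternating) auto
next
  show "\<exists>C. binary_cyclic_code 15 C \<and> code_aut 15 C \<cong> alt_group 8"
    using simplex_code_cyclic simplex_code_aut_alternating by blast
qed

end
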